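(* Let $X_1,X_2,\dots$ be i.i.d. with ${\sf E}X_1=0$ and $0<\sigma^2={\sf E}X_1^2<\infty$, let $\lambda>0$ and let $N_\lambda$ be Poisson with parameter $\lambda$ independent of $X_1,X_2,\dots$. Then for every $g\in\mathcal G$ with ${\sf E}X_1^2g(X_1)<\infty$, $$\sup_x\big|{\sf P}\big(S_{N_\lambda}<x\sigma\sqrt{\lambda}\big)-\Phi(x)\big|\le1.8546\,\frac{{\sf E}X_1^2g(X_1)}{\sigma^2g(\sigma\sqrt{\lambda})}.$$
   Context: $S_N=X_1+\dots+X_N$, $S_N=0$ if $N=0$. $\Phi$ is the standard normal distribution function. $\mathcal G$ is the class of functions $g:\mathbb R\to\mathbb R$ such that $g$ is even, $g(x)\ge0$ for all $x$ and $g(x)>0$ for $x>0$, and both $g(x)$ and $x/g(x)$ are nondecreasing on $x>0$. *)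

theory Defs
  imports "HOL-Probability.Probability"
begin

definition std_normal_cdf :: "real \<Rightarrow> real" where
  "std_normal_cdf x = (LBINT t:{..x}. std_normal_density t)"

definition class_G :: "(real \<Rightarrow> real) \<Rightarrow> bool" where
  "class_G g \<longleftrightarrow>
     (\<forall>x. g (- x) = g x) \<and> (\<forall>x. 0 \<le> g x) \<and> (\<forall>x>0. 0 < g x) \<and>
     mono_on {0<..} g \<and> mono_on {0<..} (\<lambda>x. x / g x)"

end

(*
  Put Y = X_1 / (sigma sqrt lam) and d = lam E[Y^2 min(1, |Y|)].  Monotonicity of g and of x / g(x)
  gives min(1, |x| / B) <= g(x) / g(B) for x <> 0, so that d is at most the ratio on the right-hand
  side, and it suffices to bound the distance by 1.8546 d; this is trivial unless d <= 0.5392.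

  The normalised Poisson sum has the characteristic function exp (lam (E e^{itY} - 1)).  Its exponent
  differs from -t^2/2 by at most d t^2 max(1, t/6), and its real part is at most
  -(t^2/2) (1 - d max(1, 2t/9)) because 1 - cos x >= x^2/2 - |x|^3/9.  Esseen's smoothing argument
  with the Fejer kernel, cut off at T = 3/d and with the central interval |w| <= 3 pi / 2, turns
  this into a bound with constant below 1.80.
*)

theory Submission
  imports Defs
begin

section \<open>The Fejer kernel\<close>

text \<open>The function min(1, |x| / B) itself belongs to the class, so it is the smallest member
  with g(B) = 1 and the passage to d loses nothing in the worst case. Poisson summation helps
  because the exponent lam (E e^{itY} - 1) is affine in the characteristic function of one summand:
  no complex logarithm and no product estimate occur. The obstacle is decay near the cut-off. With
  Taylor's constant 1/6 in place of 1/9 the factor 1 - d max(1, 2t/9) would become 1 - d max(1,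
  t/3), which vanishes at t = 3/d; with 1/9 it is still 1/3 there. The Fejer law suits the smoothing
  since its characteristic function lives on [-1, 1], but its tails are of order 1/u^2, so the tail
  contribution must be absorbed into the left-hand side; this requires more than half of the mass in
  the central interval. Its distribution function is an explicit sine integral, so that Fubini takes
  the place of an inversion theorem; the price is that both laws must have a first moment.\<close>

definition fejer_primitive :: "real \<Rightarrow> real" where
  "fejer_primitive u = Si u - (1 - cos u) / u"

text \<open>The density whose characteristic function is the triangle 1 - |t| on [-1, 1] and 0
  outside; away from 0 its antiderivative is \<open>fejer_primitive\<close> divided by pi. Division
  by zero gives the value 0 at the origin instead of the limit 1/(2 pi), which changes no
  integral.\<close>

definition fejer_density :: "real \<Rightarrow> real" where
  "fejer_density u = (1 - cos u) / (pi * u\<^sup>2)"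

definition fejer_distribution :: "real measure" where
  "fejer_distribution = density lborel (\<lambda>u. ennreal (fejer_density u))"

lemma fejer_density_nonneg: "0 \<le> fejer_density u"
  by (simp add: fejer_density_def)

lemma fejer_density_minus: "fejer_density (- u) = fejer_density u"
  by (simp add: fejer_density_def)

lemma fejer_density_measurable [measurable]: "fejer_density \<in> borel_measurable borel"
  unfolding fejer_density_def by measurable

lemma fejer_primitive_minus: "fejer_primitive (- u) = - fejer_primitive u"
proof (cases "u \<ge> 0")
  case True
  then show ?thesis by (simp add: fejer_primitive_def Si_neg)
next
  case False
  then show ?thesis using Si_neg[of "- u"] by (simp add: fejer_primitive_def)
qed

lemma DERIV_fejer_primitive:
  assumes "u \<noteq> 0"
  shows "(fejer_primitive has_real_derivative (1 - cos u) / u\<^sup>2) (at u)"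
proof -
  have "((\<lambda>u. (1 - cos u) / u) has_real_derivative (sin u / u - (1 - cos u) / u\<^sup>2)) (at u)"
    using assms by (auto intro!: derivative_eq_intros simp: field_simps power2_eq_square)
  from DERIV_diff[OF DERIV_Si this] show ?thesis
    using assms by (simp add: fejer_primitive_def[abs_def])
qed

lemma fejer_primitive_at_top: "(fejer_primitive \<longlongrightarrow> pi / 2) at_top"
proof -
  have "((\<lambda>u::real. (1 - cos u) / u) \<longlongrightarrow> 0) at_top"
  proof (rule Lim_null_comparison)
    show "\<forall>\<^sub>F u in at_top. norm ((1 - cos u) / u :: real) \<le> 2 / u"
      using eventually_gt_at_top[of 0]
    proof eventually_elim
      case (elim u)
      have "\<bar>1 - cos u\<bar> \<le> 2" using cos_ge_minus_one[of u] cos_le_one[of u] by linarith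
      with elim show ?case by (simp add: divide_right_mono)
    qed
    show "((\<lambda>u::real. 2 / u) \<longlongrightarrow> 0) at_top"
      by (intro tendsto_divide_0[OF tendsto_const] filterlim_at_top_imp_at_infinity filterlim_ident)
  qed
  from tendsto_diff[OF Si_at_top this] show ?thesis
    by (simp add: fejer_primitive_def[abs_def])
qed

text \<open>The defining formula divides by zero at the origin, so the limit is read off from the
  derivative of the cosine. Half-lines starting at 0, hence the total mass, depend on it.\<close>

lemma fejer_primitive_at_right_0: "(fejer_primitive \<longlongrightarrow> 0) (at_right 0)"
proof -
  have "((\<lambda>u::real. (cos u - cos 0) / (u - 0)) \<longlongrightarrow> 0) (at 0)"
    using DERIV_cos[of 0] by (simp add: has_field_derivative_iff)
  then have "((\<lambda>u::real. - ((cos u - 1) / u)) \<longlongrightarrow> - 0) (at 0)"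
    by (intro tendsto_minus) simp
  then have "((\<lambda>u::real. (1 - cos u) / u) \<longlongrightarrow> 0) (at 0)"
    by (simp add: minus_divide_left)
  moreover have "(Si \<longlongrightarrow> Si 0) (at 0)"
    using isCont_Si[of 0] by (simp add: isCont_def)
  ultimately have "(fejer_primitive \<longlongrightarrow> Si 0 - 0) (at 0)"
    unfolding fejer_primitive_def by (intro tendsto_diff)
  then show ?thesis
    by (simp add: Si_def zero_ereal_def filterlim_at_split)
qed

text \<open>The primitive \<open>-1/u - sin u/u\<^sup>2 - 1/u\<^sup>2\<close> grows faster than the primitive of the kernel; at
  \<open>u = 3\<pi>/2\<close> its last two terms cancel.\<close>

lemma fejer_primitive_lower: "pi / 2 - 2 / (3 * pi) \<le> fejer_primitive (3 * pi / 2)"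
proof -
  define Q where "Q u = fejer_primitive u + 1 / u + sin u / u\<^sup>2 + 1 / u\<^sup>2" for u :: real
  define a where "a = 3 * pi / 2"
  have a: "a > 0" by (simp add: a_def)
  have der: "\<exists>y. (Q has_real_derivative y) (at u) \<and> y \<le> 0" if "u > 0" for u
  proof -
    have d1: "((\<lambda>u. 1 / u) has_real_derivative - (1 / u\<^sup>2)) (at u)"
      using that by (auto intro!: derivative_eq_intros simp: power2_eq_square)
    have d2: "((\<lambda>u. sin u / u\<^sup>2) has_real_derivative (cos u / u\<^sup>2 - 2 * sin u / u ^ 3)) (at u)"
      using that by (auto intro!: derivative_eq_intros simp: field_simps power2_eq_square power3_eq_cube)
    have d3: "((\<lambda>u. 1 / u\<^sup>2) has_real_derivative - (2 / u ^ 3)) (at u)"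
      using that by (auto intro!: derivative_eq_intros simp: field_simps power2_eq_square power3_eq_cube)
    have "(Q has_real_derivative
        (1 - cos u) / u\<^sup>2 + - (1 / u\<^sup>2) + (cos u / u\<^sup>2 - 2 * sin u / u ^ 3) + - (2 / u ^ 3)) (at u)"
      unfolding Q_def using that
      by (intro DERIV_add DERIV_fejer_primitive d1 d2 d3) simp
    moreover have "(1 - cos u) / u\<^sup>2 + - (1 / u\<^sup>2) + (cos u / u\<^sup>2 - 2 * sin u / u ^ 3) + - (2 / u ^ 3)
        = - (2 * (1 + sin u)) / u ^ 3"
      by (simp add: diff_divide_distrib add_divide_distrib algebra_simps)
    moreover have "0 \<le> 1 + sin u" using sin_ge_minus_one[of u] by linarith
    then have "- (2 * (1 + sin u)) / u ^ 3 \<le> 0"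
      using that by (intro divide_nonpos_nonneg) auto
    ultimately show ?thesis by metis
  qed
  have anti: "Q u \<le> Q a" if "u \<ge> a" for u
    using that by (intro DERIV_nonpos_imp_nonincreasing[of a u Q]) (use a der in force)+
  have lim0: "((\<lambda>u::real. 1 / u) \<longlongrightarrow> 0) at_top"
    by (intro tendsto_divide_0[OF tendsto_const] filterlim_at_top_imp_at_infinity filterlim_ident)
  have lim1: "((\<lambda>u::real. 1 / u\<^sup>2) \<longlongrightarrow> 0) at_top"
    using tendsto_mult[OF lim0 lim0] by (simp add: power2_eq_square)
  have lim2: "((\<lambda>u::real. sin u / u\<^sup>2) \<longlongrightarrow> 0) at_top"
    by (rule Lim_null_comparison[OF _ lim1]) (auto simp: divide_right_mono)
  have "(Q \<longlongrightarrow> pi / 2 + 0 + 0 + 0) at_top"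
    unfolding Q_def by (intro tendsto_intros fejer_primitive_at_top lim0 lim1 lim2)
  moreover have "\<forall>\<^sub>F u in at_top. Q u \<le> Q a"
    using eventually_ge_at_top[of a] by eventually_elim (rule anti)
  ultimately have "pi / 2 \<le> Q a"
    using tendsto_upperbound[of Q "pi / 2" at_top "Q a"] by simp
  moreover have "sin a = - 1"
    using sin_3over2_pi by (simp add: a_def)
  ultimately show ?thesis by (simp add: Q_def a_def)
qed

lemma sets_fejer_distribution [simp, measurable_cong]: "sets fejer_distribution = sets borel"
  by (simp add: fejer_distribution_def)

lemma space_fejer_distribution [simp]: "space fejer_distribution = UNIV"
  by (simp add: fejer_distribution_def)

text \<open>Fundamental theorem of calculus on the open half-line; the boundary values are a
  right-hand limit at \<open>a\<close> and the limit at infinity.\<close>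

lemma emeasure_fejer_Ioi:
  assumes "a \<ge> 0"
  shows "emeasure fejer_distribution {a<..} = ennreal (1 / 2 - fejer_primitive a / pi)"
proof -
  have lim: "((\<lambda>u. fejer_primitive u / pi) \<longlongrightarrow> fejer_primitive a / pi) (at_right a)"
  proof (cases "a = 0")
    case True
    then show ?thesis
      using tendsto_divide[OF fejer_primitive_at_right_0 tendsto_const[of pi]]
      by (simp add: fejer_primitive_def Si_def zero_ereal_def)
  next
    case False
    then have "isCont fejer_primitive a" using DERIV_isCont DERIV_fejer_primitive by blast
    then have "(fejer_primitive \<longlongrightarrow> fejer_primitive a) (at_right a)"
      by (simp add: isCont_def filterlim_at_split)
    then show ?thesis by (intro tendsto_intros) auto
  qed
  have lim_top: "((\<lambda>u. fejer_primitive u / pi) \<longlongrightarrow> 1 / 2) at_top"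
    using tendsto_divide[OF fejer_primitive_at_top tendsto_const[of pi]] by simp
  have D: "((\<lambda>u. fejer_primitive u / pi) has_real_derivative fejer_density x) (at x)"
    if "ereal a < ereal x" for x
    using DERIV_cdivide[OF DERIV_fejer_primitive[of x], of pi] that assms
    by (simp add: fejer_density_def field_simps)
  have C: "isCont fejer_density x" if "ereal a < ereal x" for x
    unfolding fejer_density_def using that assms by (intro continuous_intros) auto
  note FTC = interval_integral_FTC_nonneg[of "ereal a" \<infinity> "\<lambda>u. fejer_primitive u / pi" fejer_density
      "fejer_primitive a / pi" "1 / 2", OF _ D C]
  have 1: "set_integrable lborel (einterval (ereal a) \<infinity>) fejer_density"
    by (rule FTC) (use lim lim_top in \<open>auto simp: fejer_density_nonneg ereal_tendsto_simps\<close>)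
  have 2: "(LBINT x=ereal a..\<infinity>. fejer_density x) = 1 / 2 - fejer_primitive a / pi"
    by (rule FTC) (use lim lim_top in \<open>auto simp: fejer_density_nonneg ereal_tendsto_simps\<close>)
  have "emeasure fejer_distribution {a<..} = (\<integral>\<^sup>+x. ennreal (indicator {a<..} x *\<^sub>R fejer_density x) \<partial>lborel)"
    by (simp add: fejer_distribution_def emeasure_density)
       (intro nn_integral_cong, simp split: split_indicator)
  also have "\<dots> = ennreal (LBINT x. indicator {a<..} x *\<^sub>R fejer_density x)"
    using 1 by (intro nn_integral_eq_integral)
      (auto simp: set_integrable_def fejer_density_nonneg)
  also have "(LBINT x. indicator {a<..} x *\<^sub>R fejer_density x) = 1 / 2 - fejer_primitive a / pi"
    using 2 by (simp add: interval_lebesgue_integral_def set_lebesgue_integral_def)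
  finally show ?thesis .
qed

text \<open>Symmetry carries the right tail to the left one, removes the linear term in the
  smoothing inequality, and lets that inequality be applied to reflected distribution
  functions.\<close>

lemma distr_uminus_fejer: "distr fejer_distribution borel uminus = fejer_distribution"
proof (rule measure_eqI)
  fix A assume "A \<in> sets (distr fejer_distribution borel uminus)"
  then have A [measurable]: "A \<in> sets borel" by simp
  have A' [measurable]: "uminus -` A \<in> sets borel"
    using measurable_sets[OF borel_measurable_uminus[OF measurable_ident_sets[OF refl]] A] by (simp add: vimage_def)
  have "emeasure (distr fejer_distribution borel uminus) A
      = (\<integral>\<^sup>+x. ennreal (fejer_density x) * indicator (uminus -` A) x \<partial>lborel)"
    by (subst emeasure_distr) (auto simp: fejer_distribution_def emeasure_density)
  also have "\<dots> = (\<integral>\<^sup>+x. ennreal (fejer_density x) * indicator (uminus -` A) x \<partial>distr lborel borel uminus)"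
    by (simp add: lborel_distr_uminus)
  also have "\<dots> = (\<integral>\<^sup>+x. ennreal (fejer_density x) * indicator A x \<partial>lborel)"
    by (subst nn_integral_distr) (auto simp: fejer_density_minus indicator_def)
  finally show "emeasure (distr fejer_distribution borel uminus) A = emeasure fejer_distribution A"
    by (simp add: fejer_distribution_def emeasure_density)
qed simp

lemma emeasure_fejer_Iio_neg:
  assumes "a \<ge> 0"
  shows "emeasure fejer_distribution {..< - a} = ennreal (1 / 2 - fejer_primitive a / pi)"
proof -
  have "emeasure fejer_distribution {..< - a} = emeasure (distr fejer_distribution borel uminus) {..< - a}"
    by (simp add: distr_uminus_fejer)
  also have "\<dots> = emeasure fejer_distribution {a<..}"
    by (subst emeasure_distr) (auto intro!: arg_cong[where f = "emeasure fejer_distribution"])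
  finally show ?thesis using emeasure_fejer_Ioi[OF assms] by simp
qed

lemma emeasure_fejer_singleton: "emeasure fejer_distribution {a} = 0"
proof -
  have "AE x in lborel. x \<in> {a} \<longrightarrow> ennreal (fejer_density x) \<le> 0"
    using AE_lborel_singleton[of a] by eventually_elim auto
  then show ?thesis
    by (simp add: fejer_distribution_def emeasure_density nn_integral_indicator_singleton)
qed

lemma real_distribution_fejer: "real_distribution fejer_distribution"
proof -
  have "emeasure fejer_distribution UNIV = emeasure fejer_distribution ({..<0} \<union> ({0} \<union> {0<..}))"
    by (intro arg_cong[where f = "emeasure fejer_distribution"]) auto
  also have "\<dots> = emeasure fejer_distribution {..<0} +
      (emeasure fejer_distribution {0} + emeasure fejer_distribution {0<..})"
    by (subst plus_emeasure [symmetric]; (subst plus_emeasure [symmetric])?) auto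
  also have "\<dots> = ennreal (1 / 2) + ennreal (1 / 2)"
    using emeasure_fejer_Iio_neg[of 0] emeasure_fejer_Ioi[of 0]
    by (simp add: emeasure_fejer_singleton fejer_primitive_def Si_def zero_ereal_def)
  also have "\<dots> = 1" by (subst ennreal_plus[symmetric]) auto
  finally show ?thesis
    by (auto simp: real_distribution_def real_distribution_axioms_def intro!: prob_spaceI)
qed

interpretation fejer: real_distribution fejer_distribution
  by (rule real_distribution_fejer)

text \<open>To the right of 0 the function is nondecreasing with limit pi/2. The bound matters
  because \<open>ennreal\<close> truncates negative numbers to 0: the tail formula can be read in
  the reals only once it is known to be nonnegative.\<close>

lemma fejer_primitive_le:
  assumes "a \<ge> 0"
  shows "fejer_primitive a \<le> pi / 2"
proof (rule ccontr)
  assume *: "\<not> ?thesis"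
  then have a: "a > 0" using assms
    by (cases "a = 0") (auto simp: fejer_primitive_def Si_def zero_ereal_def)
  have "fejer_primitive a \<le> fejer_primitive u" if "u \<ge> a" for u
  proof (rule DERIV_nonneg_imp_nondecreasing[OF that])
    fix x assume x: "a \<le> x" "x \<le> u"
    show "\<exists>y. (fejer_primitive has_real_derivative y) (at x) \<and> 0 \<le> y"
      using x a DERIV_fejer_primitive[of x]
      by (intro exI[of _ "(1 - cos x) / x\<^sup>2"]) auto
  qed
  then have "\<forall>\<^sub>F u in at_top. fejer_primitive a \<le> fejer_primitive u"
    by (intro eventually_mono[OF eventually_ge_at_top[of a]])
  then have "fejer_primitive a \<le> pi / 2"
    by (intro tendsto_lowerbound[OF fejer_primitive_at_top]) auto
  with * show False by simp
qed

lemma measure_fejer_Ioi: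
  assumes "a \<ge> 0"
  shows "measure fejer_distribution {a<..} = 1 / 2 - fejer_primitive a / pi"
proof -
  have "fejer_primitive a / pi \<le> 1 / 2"
    using fejer_primitive_le[OF assms] by (simp add: divide_le_eq)
  then show ?thesis
    unfolding measure_def emeasure_fejer_Ioi[OF assms] by (intro enn2real_ennreal) simp
qed

lemma measure_fejer_Iio_neg:
  assumes "a \<ge> 0"
  shows "measure fejer_distribution {..< - a} = 1 / 2 - fejer_primitive a / pi"
proof -
  have "fejer_primitive a / pi \<le> 1 / 2"
    using fejer_primitive_le[OF assms] by (simp add: divide_le_eq)
  then show ?thesis
    unfolding measure_def emeasure_fejer_Iio_neg[OF assms] by (intro enn2real_ennreal) simp
qed

text \<open>For negative \<open>u\<close> this is the left tail together with oddness of the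
  primitive; otherwise it is the complement of the right tail, there being no atom at
  \<open>u\<close>.\<close>

lemma measure_fejer_Iio:
  "measure fejer_distribution {..<u} = 1 / 2 + fejer_primitive u / pi"
proof (cases "u < 0")
  case True
  then show ?thesis using measure_fejer_Iio_neg[of "- u"] by (simp add: fejer_primitive_minus)
next
  case False
  have "measure fejer_distribution {u..} = measure fejer_distribution ({u} \<union> {u<..})"
    by (intro arg_cong[where f = "measure fejer_distribution"]) auto
  also have "\<dots> = measure fejer_distribution {u<..}"
    using emeasure_fejer_singleton[of u]
    by (subst fejer.finite_measure_Union) (auto simp: fejer.emeasure_eq_measure)
  also have "\<dots> = 1 / 2 - fejer_primitive u / pi"
    using False by (simp add: measure_fejer_Ioi)
  finally show ?thesis
    using fejer.prob_compl[of "{u..}"] by (simp add: Compl_eq_Diff_UNIV[symmetric] Compl_atLeast)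
qed

text \<open>Each of the two tails has mass at most 1/2 - (pi/2 - 2/(3 pi)) / pi = 2/(3
  pi^2).\<close>

lemma measure_fejer_central:
  "1 - 4 / (3 * pi\<^sup>2) \<le> measure fejer_distribution {- (3 * pi / 2)..3 * pi / 2}"
proof -
  define a where "a = 3 * pi / 2"
  have a: "a \<ge> 0" by (simp add: a_def)
  have "measure fejer_distribution {- a..a} = 1 - measure fejer_distribution ({..< - a} \<union> {a<..})"
  proof -
    have "{- a..a} = space fejer_distribution - ({..< - a} \<union> {a<..})" by auto
    then show ?thesis using fejer.prob_compl[of "{..< - a} \<union> {a<..}"] by simp
  qed
  moreover have "measure fejer_distribution ({..< - a} \<union> {a<..})
      \<le> measure fejer_distribution {..< - a} + measure fejer_distribution {a<..}"
    by (rule measure_Un_le) auto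
  ultimately have "2 * fejer_primitive a / pi \<le> measure fejer_distribution {- a..a}"
    using a by (simp add: measure_fejer_Ioi measure_fejer_Iio_neg)
  moreover have "1 - 4 / (3 * pi\<^sup>2) = 2 * (pi / 2 - 2 / (3 * pi)) / pi"
    by (simp add: field_simps power2_eq_square)
  moreover have "\<dots> \<le> 2 * fejer_primitive a / pi"
    using fejer_primitive_lower unfolding a_def
    by (intro divide_right_mono mult_left_mono) auto
  ultimately show ?thesis by (simp add: a_def)
qed

text \<open>Split (1 - t)/t into 1/t - 1: the first part integrates to \<open>Si u\<close>, the
  second to (1 - cos u)/u. This is Fourier inversion for the triangle, with an integrand bounded by
  |u|. The end points, where quotients may take default values, form a null set.\<close>

lemma fejer_primitive_eq_LBINT:
  "fejer_primitive u = (LBINT t:{0..1}. (1 - t) * sin (t * u) / t)"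
proof -
  have 1: "set_integrable lborel {0<..<1} (\<lambda>t. sin (t * u) / t)"
    using integrable_sinc'[of 1 u] by (simp add: interval_lebesgue_integrable_def)
  have 2: "(LBINT t:{0<..<1}. sin (t * u) / t) = Si u"
    using LBINT_I0c_sin_scale_divide[of 1 u] Si_neg[of "- u"]
    by (cases "u = 0"; cases "u > 0")
       (auto simp: interval_lebesgue_integral_def one_ereal_def zero_ereal_def sgn_if Si_def)
  have 3: "set_integrable lborel {0..1} (\<lambda>t. sin (t * u))"
    by (intro borel_integrable_atLeastAtMost' continuous_intros)
  have 4: "(LBINT t:{0..1}. sin (t * u)) = (1 - cos u) / u"
  proof (cases "u = 0")
    case False
    have "(LBINT t. indicator {0..1} t *\<^sub>R sin (t * u)) = - cos (1 * u) / u - (- cos (0 * u) / u)"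
      by (rule integral_FTC_Icc)
         (auto intro!: derivative_eq_intros continuous_intros
           simp: has_real_derivative_iff_has_vector_derivative[symmetric] False)
    then show ?thesis by (simp add: set_lebesgue_integral_def diff_divide_distrib)
  qed (simp add: set_lebesgue_integral_def)
  have "(LBINT t:{0..1}. (1 - t) * sin (t * u) / t)
      = (LBINT t:{0<..<1}. sin (t * u) / t - sin (t * u))"
    unfolding set_lebesgue_integral_def
  proof (rule integral_cong_AE)
    show "AE t in lborel. indicat_real {0..1} t *\<^sub>R ((1 - t) * sin (t * u) / t) =
        indicat_real {0<..<1} t *\<^sub>R (sin (t * u) / t - sin (t * u))"
      using AE_lborel_singleton[of 0] AE_lborel_singleton[of 1]
      by eventually_elim (auto simp: field_simps split: split_indicator)
  qed auto
  also have "\<dots> = Si u - (LBINT t:{0<..<1}. sin (t * u))"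
    using 1 2 set_integrable_subset[OF 3, of "{0<..<1}"] by (subst set_integral_diff) (auto simp: greaterThanLessThan_subseteq_atLeastAtMost_iff)
  also have "(LBINT t:{0<..<1}. sin (t * u)) = (LBINT t:{0..1}. sin (t * u))"
    unfolding set_lebesgue_integral_def
  proof (rule integral_cong_AE)
    show "AE t in lborel. indicat_real {0<..<1} t *\<^sub>R sin (t * u) = indicat_real {0..1} t *\<^sub>R sin (t * u)"
      using AE_lborel_singleton[of 0] AE_lborel_singleton[of 1]
      by eventually_elim (auto split: split_indicator)
  qed auto
  finally show ?thesis using 4 by (simp add: fejer_primitive_def)
qed

section \<open>Smoothing by the Fejer law in terms of characteristic functions\<close>

lemma integral_measure_convolution:
  assumes "real_distribution M" "real_distribution N"
  shows "(\<integral>w. measure M {..<x - w} \<partial>N) = (\<integral>s. measure N {..<x - s} \<partial>M)"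
proof -
  interpret M: real_distribution M by fact
  interpret N: real_distribution N by fact
  interpret MN: pair_prob_space M N ..
  have "integrable (M \<Otimes>\<^sub>M N) (\<lambda>(s, w). indicat_real {..<x} (s + w))"
    by (rule MN.integrable_const_bound[of _ 1]) (auto simp: indicator_def)
  then have "(\<integral>w. (\<integral>s. indicat_real {..<x} (s + w) \<partial>M) \<partial>N)
      = (\<integral>s. (\<integral>w. indicat_real {..<x} (s + w) \<partial>N) \<partial>M)"
    by (rule MN.Fubini_integral)
  moreover have "(\<integral>s. indicat_real {..<x} (s + w) \<partial>M) = measure M {..<x - w}" for w
  proof -
    have "(\<lambda>s. indicat_real {..<x} (s + w)) = indicat_real {..<x - w}"
      by (auto simp: indicator_def fun_eq_iff)
    then show ?thesis by simp
  qed
  moreover have "(\<integral>w. indicat_real {..<x} (s + w) \<partial>N) = measure N {..<x - s}" for s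
  proof -
    have "(\<lambda>w. indicat_real {..<x} (s + w)) = indicat_real {..<x - s}"
      by (auto simp: indicator_def fun_eq_iff)
    then show ?thesis by simp
  qed
  ultimately show ?thesis by simp
qed

text \<open>The integrand is minus the imaginary part of exp(-itx) exp(its), and Im commutes with
  the integral.\<close>

lemma (in real_distribution) integral_sin_eq_char:
  "(\<integral>s. sin (t * (x - s)) \<partial>M) = - Im (iexp (- (t * x)) * char M t)"
proof -
  have "integrable M (\<lambda>s. iexp (t * s))"
    by (intro integrable_iexp) auto
  then have int: "integrable M (\<lambda>s. iexp (- (t * x)) * iexp (t * s))"
    by (intro integrable_mult_right)
  have "- Im (iexp (- (t * x)) * char M t) = - Im (CLINT s|M. iexp (- (t * x)) * iexp (t * s))"
    by (simp add: char_def)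
  also have "\<dots> = - (\<integral>s. Im (iexp (- (t * x)) * iexp (t * s)) \<partial>M)"
    using int by (simp only: integral_Im)
  also have "\<dots> = (\<integral>s. - Im (iexp (- (t * x)) * iexp (t * s)) \<partial>M)"
    by (rule Bochner_Integration.integral_minus[symmetric])
  also have "\<dots> = (\<integral>s. sin (t * (x - s)) \<partial>M)"
    by (intro Bochner_Integration.integral_cong refl)
       (simp add: Re_exp Im_exp sin_diff right_diff_distrib)
  finally show ?thesis ..
qed

text \<open>Swap the roles of the two laws, insert the sine representation of the Fejer distribution
  function and swap the integrals. The first moment of \<open>M\<close> makes this legitimate:
  |sin(t(x - s))| / t is at most |x - s|, which tames the singularity at t = 0.\<close>

lemma
  assumes "real_distribution M" and int: "integrable M (\<lambda>s. s)"
  shows set_integrable_sin_fejer: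
      "set_integrable lborel {0..1} (\<lambda>t. (1 - t) / t * (\<integral>s. sin (t * (x - s)) \<partial>M))" (is ?int)
    and integral_measure_fejer:
      "(\<integral>w. measure M {..<x - w} \<partial>fejer_distribution)
        = 1 / 2 + (LBINT t:{0..1}. (1 - t) / t * (\<integral>s. sin (t * (x - s)) \<partial>M)) / pi" (is ?eq)
proof -
  interpret M: real_distribution M by fact
  interpret P: pair_sigma_finite M lborel ..
  define f where "f s t = indicator {0..1} t *\<^sub>R ((1 - t) * sin (t * (x - s)) / t)" for s t :: real
  have f_le: "\<bar>f s t\<bar> \<le> indicator {0..1} t * \<bar>x - s\<bar>" for s t
  proof (cases "0 < t \<and> t \<le> 1")
    case True
    have "\<bar>(1 - t) * sin (t * (x - s))\<bar> \<le> 1 * \<bar>t * (x - s)\<bar>"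
      unfolding abs_mult by (intro mult_mono) (use True abs_sin_x_le_abs_x[of "t * (x - s)"] in \<open>auto simp: abs_mult\<close>)
    then show ?thesis using True by (simp add: f_def divide_le_eq abs_mult mult.commute)
  qed (auto simp: f_def split: split_indicator)
  have [measurable]: "(\<lambda>(s, t). f s t) \<in> borel_measurable (M \<Otimes>\<^sub>M lborel)"
    unfolding f_def by measurable
  have ind: "integrable lborel (\<lambda>t::real. indicat_real {0..1} t * \<bar>x - s\<bar>)" for s
    by (intro integrable_mult_left integrable_real_indicator) auto
  have int_f: "integrable lborel (f s)" for s
    by (rule Bochner_Integration.integrable_bound[OF ind]) (use f_le in \<open>auto simp: f_def\<close>)
  have le: "(LBINT t. norm (f s t)) \<le> \<bar>x - s\<bar>" for s
  proof -
    have "(LBINT t. norm (f s t)) \<le> (LBINT t::real. indicator {0..1} t * \<bar>x - s\<bar>)"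
      by (intro integral_mono integrable_norm int_f ind) (use f_le in auto)
    then show ?thesis by simp
  qed
  have fub: "integrable (M \<Otimes>\<^sub>M lborel) (\<lambda>(s, t). f s t)"
  proof (rule P.Fubini_integrable)
    show "integrable M (\<lambda>s. LBINT t. norm (case (s, t) of (s, t) \<Rightarrow> f s t))"
    proof (rule Bochner_Integration.integrable_bound)
      show "integrable M (\<lambda>s. \<bar>x - s\<bar>)" using int by simp
    qed (use le in \<open>auto intro!: AE_I2 integral_nonneg_AE\<close>)
  qed (auto simp: int_f)
  have inner: "(\<integral>s. f s t \<partial>M) = indicator {0..1} t *\<^sub>R ((1 - t) / t * (\<integral>s. sin (t * (x - s)) \<partial>M))" for t
    by (simp add: f_def divide_inverse mult_ac)
  show ?int
    using P.integrable_snd[OF fub] unfolding inner set_integrable_def .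
  have prim: "(LBINT t. f s t) = fejer_primitive (x - s)" for s
    by (simp add: fejer_primitive_eq_LBINT f_def set_lebesgue_integral_def)
  have int_prim: "integrable M (\<lambda>s. fejer_primitive (x - s))"
    using P.integrable_fst[OF fub] unfolding prim .
  have "(\<integral>w. measure M {..<x - w} \<partial>fejer_distribution) = (\<integral>s. measure fejer_distribution {..<x - s} \<partial>M)"
    by (intro integral_measure_convolution real_distribution_fejer) fact
  also have "\<dots> = (\<integral>s. 1 / 2 + fejer_primitive (x - s) / pi \<partial>M)"
    by (simp add: measure_fejer_Iio)
  also have "\<dots> = 1 / 2 + (\<integral>s. fejer_primitive (x - s) \<partial>M) / pi"
    using int_prim M.prob_space by simp
  also have "(\<integral>s. fejer_primitive (x - s) \<partial>M) = (\<integral>s. (LBINT t. f s t) \<partial>M)"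
    by (simp add: prim)
  also have "\<dots> = (LBINT t. (\<integral>s. f s t \<partial>M))"
    by (rule P.Fubini_integral[OF fub, symmetric])
  also have "\<dots> = (LBINT t:{0..1}. (1 - t) / t * (\<integral>s. sin (t * (x - s)) \<partial>M))"
    by (simp add: inner set_lebesgue_integral_def)
  finally show ?eq .
qed

text \<open>The constants 1/2 cancel in the difference. The factor \<open>t\<close> in the
  hypothesis absorbs the 1/t of the sine representation.\<close>

lemma integral_measure_fejer_diff_le:
  assumes M: "real_distribution M" "integrable M (\<lambda>s. s)"
    and N: "real_distribution N" "integrable N (\<lambda>s. s)"
    and h: "set_integrable lborel {0..1} h"
    and bound: "\<And>t. 0 < t \<Longrightarrow> t \<le> 1 \<Longrightarrow> cmod (char M t - char N t) \<le> t * h t"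
  shows "\<bar>(\<integral>w. measure M {..<x - w} \<partial>fejer_distribution) - (\<integral>w. measure N {..<x - w} \<partial>fejer_distribution)\<bar>
    \<le> (LBINT t:{0..1}. h t) / pi"
proof -
  interpret M: real_distribution M by fact
  interpret N: real_distribution N by fact
  define A where "A L t = (1 - t) / t * (\<integral>s. sin (t * (x - s)) \<partial>L)" for L :: "real measure" and t
  note int = set_integrable_sin_fejer[OF M, of x] set_integrable_sin_fejer[OF N, of x]
  have le: "\<bar>A M t - A N t\<bar> \<le> h t" if "0 < t" "t \<le> 1" for t
  proof -
    have "Im (iexp (- (t * x)) * (char M t - char N t)) = Im (iexp (- (t * x)) * char M t) - Im (iexp (- (t * x)) * char N t)"
      by (simp only: right_diff_distrib minus_complex.sel)
    then have "A M t - A N t = - ((1 - t) / t * Im (iexp (- (t * x)) * (char M t - char N t)))"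
      unfolding A_def M.integral_sin_eq_char N.integral_sin_eq_char
      by (simp only: right_diff_distrib[of "(1 - t) / t"] mult_minus_right)
    then have "\<bar>A M t - A N t\<bar> = (1 - t) / t * \<bar>Im (iexp (- (t * x)) * (char M t - char N t))\<bar>"
      using that by (simp add: abs_mult)
    \<comment> \<open>The triangle weight 1 - t is estimated by 1.\<close>
    also have "\<dots> \<le> 1 / t * cmod (iexp (- (t * x)) * (char M t - char N t))"
      using that by (intro mult_mono divide_right_mono abs_Im_le_cmod) auto
    also have "\<dots> = 1 / t * cmod (char M t - char N t)"
      by (simp add: norm_mult norm_exp_i_times)
    also have "\<dots> \<le> 1 / t * (t * h t)"
      using that bound by (intro mult_left_mono) auto
    finally show ?thesis using that by simp
  qed
  have diff: "(\<integral>w. measure M {..<x - w} \<partial>fejer_distribution) - (\<integral>w. measure N {..<x - w} \<partial>fejer_distribution)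
      = (LBINT t:{0..1}. A M t - A N t) / pi"
    using int by (simp add: integral_measure_fejer[OF M] integral_measure_fejer[OF N] A_def
        set_integral_diff diff_divide_distrib)
  have "\<bar>LBINT t:{0..1}. A M t - A N t\<bar> \<le> (LBINT t:{0..1}. h t)"
    unfolding set_lebesgue_integral_def
  proof (rule integral_abs_bound[THEN order_trans], rule integral_mono_AE)
    show "integrable lborel (\<lambda>t. \<bar>indicat_real {0..1} t *\<^sub>R (A M t - A N t)\<bar>)"
      using set_integral_diff(1)[OF int] by (intro integrable_abs) (simp add: A_def set_integrable_def)
    show "integrable lborel (\<lambda>t. indicat_real {0..1} t *\<^sub>R h t)"
      using h by (simp add: set_integrable_def)
    show "AE t in lborel. \<bar>indicat_real {0..1} t *\<^sub>R (A M t - A N t)\<bar> \<le> indicat_real {0..1} t *\<^sub>R h t"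
      using AE_lborel_singleton[of 0]
      by eventually_elim (use le in \<open>auto split: split_indicator\<close>)
  qed
  then show ?thesis
    unfolding diff by (simp add: divide_right_mono)
qed

section \<open>Esseen smoothing\<close>

text \<open>Evaluate the smoothed difference at x + \<alpha>. For |w| \<le> \<alpha> the point x +
  \<alpha> - w lies to the right of x, so monotonicity of \<open>F\<close> and the Lipschitz bound
  on \<open>G\<close> keep the difference above F x - G x - L(\<alpha> - w); for all other w it is
  at least -\<eta>.\<close>

lemma one_sided_smoothing:
  fixes F G :: "real \<Rightarrow> real"
  assumes "real_distribution W" and sym: "distr W borel uminus = W"
    and [measurable]: "F \<in> borel_measurable borel" "G \<in> borel_measurable borel"
    and "mono F" and G: "\<And>x y. x \<le> y \<Longrightarrow> G y - G x \<le> L * (y - x)"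
    and close: "\<And>x. \<bar>F x - G x\<bar> \<le> \<eta>"
    and smooth: "\<And>x. (\<integral>w. F (x - w) - G (x - w) \<partial>W) \<le> B"
    and "\<alpha> \<ge> 0"
  shows "(F x - G x - L * \<alpha>) * measure W {-\<alpha>..\<alpha>} \<le> B + \<eta> * (1 - measure W {-\<alpha>..\<alpha>})"
proof -
  interpret W: real_distribution W by fact
  define A where "A = {-\<alpha>..\<alpha>}"
  have [measurable]: "A \<in> sets borel" by (simp add: A_def)
  define D where "D y = F y - G y" for y
  have [measurable]: "D \<in> borel_measurable borel" unfolding D_def by measurable
  have iA: "integrable W (\<lambda>w. indicator A w :: real)" by (rule W.integrable_const_bound[of _ 1]) auto
  have iw: "integrable W (\<lambda>w. indicator A w * w :: real)"
    by (rule W.integrable_const_bound[of _ \<alpha>]) (use \<open>\<alpha> \<ge> 0\<close> in \<open>auto simp: A_def split: split_indicator\<close>)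
  have iD: "integrable W (\<lambda>w. D (x + \<alpha> - w))"
    by (rule W.integrable_const_bound[of _ \<eta>]) (use close in \<open>auto simp: D_def\<close>)
  \<comment> \<open>By symmetry the term L w integrates to 0 over the central interval, so the shift
    costs L\<alpha> rather than the worst case 2L\<alpha>.\<close>
  have "(\<integral>w. indicator A w * w \<partial>W) = (\<integral>w. indicator A w * w \<partial>distr W borel uminus)"
    by (simp add: sym)
  also have "\<dots> = (\<integral>w. indicator A (- w) * (- w) \<partial>W)"
    by (rule integral_distr) auto
  also have "\<dots> = (\<integral>w. - (indicator A w * w) \<partial>W)"
    by (intro Bochner_Integration.integral_cong refl) (auto simp: A_def split: split_indicator)
  also have "\<dots> = - (\<integral>w. indicator A w * w \<partial>W)"
    by (rule Bochner_Integration.integral_minus)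
  finally have odd: "(\<integral>w. indicator A w * w \<partial>W) = 0" by simp
  have pw: "(D x - L * \<alpha> + \<eta>) * indicator A w + L * (indicator A w * w) - \<eta> \<le> D (x + \<alpha> - w)" for w
  proof (cases "w \<in> A")
    case True
    then have "x \<le> x + \<alpha> - w" by (simp add: A_def)
    then have "F x \<le> F (x + \<alpha> - w)" "G (x + \<alpha> - w) - G x \<le> L * (\<alpha> - w)"
      using monoD[OF \<open>mono F\<close>, of x "x + \<alpha> - w"] G[of x "x + \<alpha> - w"] by (simp_all add: algebra_simps)
    with True show ?thesis by (simp add: D_def algebra_simps)
  next
    case False
    then show ?thesis using close[of "x + \<alpha> - w"] by (simp add: D_def abs_le_iff)
  qed
  have "(D x - L * \<alpha> + \<eta>) * measure W A - \<eta>
      = (\<integral>w. (D x - L * \<alpha> + \<eta>) * indicator A w + L * (indicator A w * w) - \<eta> \<partial>W)"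
    using iA iw odd W.prob_space by simp
  also have "\<dots> \<le> (\<integral>w. D (x + \<alpha> - w) \<partial>W)"
    using iA iw by (intro integral_mono iD pw) auto
  also have "\<dots> \<le> B" using smooth[of "x + \<alpha>"] by (simp add: D_def)
  finally show ?thesis by (simp add: D_def A_def algebra_simps)
qed

text \<open>After smoothing, the supremum \<eta> of the distance occurs on both sides. With q the
  mass of the central interval, solving for \<eta> leaves the factor 2q - 1 on the left, which
  becomes 1 - 8/(3 pi^2) through q \<ge> 1 - 4/(3 pi^2).\<close>

lemma esseen_smoothing:
  assumes M: "real_distribution M" "integrable M (\<lambda>s. s)"
    and N: "real_distribution N" "integrable N (\<lambda>s. s)"
    and lip: "\<And>x y. x \<le> y \<Longrightarrow> measure N {x..<y} \<le> L * (y - x)"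
    and h: "set_integrable lborel {0..1} h"
    and bound: "\<And>t. 0 < t \<Longrightarrow> t \<le> 1 \<Longrightarrow> cmod (char M t - char N t) \<le> t * h t"
  shows "\<bar>measure M {..<x} - measure N {..<x}\<bar> * (1 - 8 / (3 * pi\<^sup>2))
    \<le> (LBINT t:{0..1}. h t) / pi + L * (3 * pi / 2) * (1 - 4 / (3 * pi\<^sup>2))"
proof -
  interpret M: real_distribution M by fact
  interpret N: real_distribution N by fact
  define F where "F y = measure M {..<y}" for y
  define G where "G y = measure N {..<y}" for y
  define \<alpha> where "\<alpha> = 3 * pi / 2"
  define q where "q = measure fejer_distribution {-\<alpha>..\<alpha>}"
  define B where "B = (LBINT t:{0..1}. h t) / pi"
  define \<eta> where "\<eta> = (SUP y. \<bar>F y - G y\<bar>)"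
  have mono: "mono F" "mono G"
    unfolding F_def G_def
    by (rule monoI, rule M.finite_measure_mono, simp, simp)
      (rule monoI, rule N.finite_measure_mono, simp, simp)
  have [measurable]: "F \<in> borel_measurable borel" "G \<in> borel_measurable borel"
    by (rule borel_measurable_mono[OF mono(1)], rule borel_measurable_mono[OF mono(2)])
  have "\<bar>F y - G y\<bar> \<le> 1" for y
    using M.prob_le_1[of "{..<y}"] N.prob_le_1[of "{..<y}"] measure_nonneg[of M "{..<y}"]
      measure_nonneg[of N "{..<y}"] unfolding F_def G_def by linarith
  then have bdd: "bdd_above (range (\<lambda>y. \<bar>F y - G y\<bar>))" by (intro bdd_aboveI[of _ 1]) auto
  have close: "\<bar>F y - G y\<bar> \<le> \<eta>" for y
    unfolding \<eta>_def by (rule cSUP_upper[OF UNIV_I bdd])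
  have G_lip: "G z - G y \<le> L * (z - y)" if "y \<le> z" for y z
  proof -
    have "measure N ({..<z} - {..<y}) = measure N {..<z} - measure N {..<y}"
      using that by (intro N.finite_measure_Diff) auto
    moreover have "{..<z} - {..<y} = {y..<z}" by auto
    ultimately have "G z - G y = measure N {y..<z}" by (simp add: G_def)
    then show ?thesis using lip[OF that] by simp
  qed
  have int: "integrable fejer_distribution (\<lambda>w. F (y - w))" "integrable fejer_distribution (\<lambda>w. G (y - w))" for y
  proof -
    have "(\<lambda>w. F (y - w)) \<in> borel_measurable fejer_distribution" by measurable
    then show "integrable fejer_distribution (\<lambda>w. F (y - w))"
      by (intro fejer.integrable_const_bound[of _ 1]) (simp_all add: F_def)
    have "(\<lambda>w. G (y - w)) \<in> borel_measurable fejer_distribution" by measurable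
    then show "integrable fejer_distribution (\<lambda>w. G (y - w))"
      by (intro fejer.integrable_const_bound[of _ 1]) (simp_all add: G_def)
  qed
  have smooth: "\<bar>\<integral>w. F (y - w) - G (y - w) \<partial>fejer_distribution\<bar> \<le> B" for y
    using integral_measure_fejer_diff_le[OF M N h bound, of y] int
    unfolding B_def by (simp add: F_def G_def)
  have up: "(F y - G y - L * \<alpha>) * q \<le> B + \<eta> * (1 - q)" for y
    unfolding q_def
    by (rule one_sided_smoothing[OF real_distribution_fejer distr_uminus_fejer _ _ mono(1) G_lip close])
       (use smooth in \<open>simp_all add: \<alpha>_def abs_le_iff\<close>)
  \<comment> \<open>The opposite sign comes from reflection: -F(-y) is again nondecreasing, -G(-y)
    has the same Lipschitz constant, and their difference is G(-y) - F(-y).\<close>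
  have dn: "(- F (- y) - (- G (- y)) - L * \<alpha>) * q \<le> B + \<eta> * (1 - q)" for y
    unfolding q_def
  proof (rule one_sided_smoothing[OF real_distribution_fejer distr_uminus_fejer,
        where F = "\<lambda>y. - F (- y)" and G = "\<lambda>y. - G (- y)"])
    show "mono (\<lambda>y. - F (- y))" using mono(1) by (auto simp: mono_def)
    show "- G (- z) - - G (- y) \<le> L * (z - y)" if "y \<le> z" for y z
      using G_lip[of "- z" "- y"] that by simp
    show "\<bar>- F (- y) - - G (- y)\<bar> \<le> \<eta>" for y
      using close[of "- y"] by simp
    show "(\<integral>w. - F (- (y - w)) - - G (- (y - w)) \<partial>fejer_distribution) \<le> B" for y
    proof -
      have "(\<integral>w. F (- y - w) - G (- y - w) \<partial>fejer_distribution)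
          = (\<integral>w. F (- y - w) - G (- y - w) \<partial>distr fejer_distribution borel uminus)"
        by (simp add: distr_uminus_fejer)
      also have "\<dots> = (\<integral>w. F (- y - - w) - G (- y - - w) \<partial>fejer_distribution)"
        by (rule integral_distr) auto
      also have "\<dots> = (\<integral>w. - (- F (- (y - w)) - - G (- (y - w))) \<partial>fejer_distribution)"
        by (simp add: algebra_simps)
      also have "\<dots> = - (\<integral>w. - F (- (y - w)) - - G (- (y - w)) \<partial>fejer_distribution)"
        by (rule Bochner_Integration.integral_minus)
      finally show ?thesis using smooth[of "- y"] by linarith
    qed
    show "0 \<le> \<alpha>" by (simp add: \<alpha>_def)
  qed measurable
  have q: "1 - 4 / (3 * pi\<^sup>2) \<le> q" using measure_fejer_central by (simp add: q_def \<alpha>_def)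
  have "3 * 3 < pi * pi" using pi_gt3 by (intro mult_strict_mono) auto
  then have q_half: "4 / (3 * pi\<^sup>2) < 1 / 2" by (simp add: power2_eq_square divide_less_eq)
  have "q > 0" using q q_half by linarith
  have "\<bar>F y - G y\<bar> \<le> L * \<alpha> + (B + \<eta> * (1 - q)) / q" for y
  proof -
    have "F y - G y - L * \<alpha> \<le> (B + \<eta> * (1 - q)) / q"
      unfolding pos_le_divide_eq[OF \<open>q > 0\<close>] by (rule up)
    moreover have "- F (- (- y)) - (- G (- (- y))) - L * \<alpha> \<le> (B + \<eta> * (1 - q)) / q"
      unfolding pos_le_divide_eq[OF \<open>q > 0\<close>] by (rule dn)
    ultimately show ?thesis by simp
  qed
  then have "\<eta> \<le> L * \<alpha> + (B + \<eta> * (1 - q)) / q"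
    by (subst (1) \<eta>_def, intro cSUP_least) simp_all
  then have "\<eta> - L * \<alpha> \<le> (B + \<eta> * (1 - q)) / q" by simp
  then have \<eta>: "(2 * \<eta> - L * \<alpha>) * q \<le> B + \<eta>"
    unfolding pos_le_divide_eq[OF \<open>q > 0\<close>] by (simp add: left_diff_distrib right_diff_distrib)
  have "0 \<le> \<eta>" using close[of 0] by linarith
  have "0 \<le> B" using smooth[of 0] by linarith
  \<comment> \<open>Only a lower bound for \<open>q\<close> is known, so it can replace
    \<open>q\<close> only under a nonnegative factor. If 2\<eta> < L\<alpha>, that inequality itself
    already gives the claim.\<close>
  have "\<eta> * (1 - 8 / (3 * pi\<^sup>2)) \<le> B + L * \<alpha> * (1 - 4 / (3 * pi\<^sup>2))"
  proof (cases "2 * \<eta> - L * \<alpha> \<ge> 0")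
    case True
    then have "(2 * \<eta> - L * \<alpha>) * (1 - 4 / (3 * pi\<^sup>2)) \<le> B + \<eta>"
      using mult_left_mono[OF q True] \<eta> by linarith
    moreover have "8 / (3 * pi\<^sup>2) = 2 * (4 / (3 * pi\<^sup>2))" by simp
    ultimately show ?thesis by (simp only: right_diff_distrib left_diff_distrib mult_1_right mult_ac)
  next
    case False
    have "\<eta> * (1 - 8 / (3 * pi\<^sup>2)) \<le> \<eta> * (2 * (1 - 4 / (3 * pi\<^sup>2)))"
      using \<open>0 \<le> \<eta>\<close> by (intro mult_left_mono) auto
    also have "\<dots> \<le> (L * \<alpha>) * (1 - 4 / (3 * pi\<^sup>2))"
      using mult_right_mono[of "2 * \<eta>" "L * \<alpha>" "1 - 4 / (3 * pi\<^sup>2)"] False q_half by (simp add: mult_ac)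
    finally show ?thesis using \<open>0 \<le> B\<close> by linarith
  qed
  moreover have "\<bar>F x - G x\<bar> * (1 - 8 / (3 * pi\<^sup>2)) \<le> \<eta> * (1 - 8 / (3 * pi\<^sup>2))"
    using q_half by (intro mult_right_mono close) (simp add: field_simps)
  ultimately show ?thesis by (simp add: F_def G_def B_def \<alpha>_def)
qed

section \<open>Poisson random sums\<close>

lemma sums_indicator_singleton:
  fixes f :: "nat \<Rightarrow> 'b::real_normed_vector"
  shows "(\<lambda>k. indicator {k} n *\<^sub>R f k) sums f n"
proof -
  have "(\<lambda>k. indicator {k} n *\<^sub>R f k) = (\<lambda>k. if k = n then f k else 0)"
    by (auto simp: fun_eq_iff)
  then show ?thesis using sums_single[of n f] by simp
qed

text \<open>Decompose according to the value of \<open>N\<close>: for each \<omega> at most one term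
  of the series is nonzero. The values are Banach-valued because the lemma serves both the real sum
  and its complex exponentials.\<close>

lemma (in prob_space)
  fixes f :: "nat \<Rightarrow> 'a \<Rightarrow> 'b::{banach, second_countable_topology}"
  assumes int: "\<And>k. integrable M (\<lambda>\<omega>. indicat_real {k} (N \<omega>) *\<^sub>R f k \<omega>)"
    and sum: "summable (\<lambda>k. \<integral>\<omega>. norm (indicat_real {k} (N \<omega>) *\<^sub>R f k \<omega>) \<partial>M)"
  shows integrable_random_index: "integrable M (\<lambda>\<omega>. f (N \<omega>) \<omega>)"
    and integral_random_index:
      "(\<integral>\<omega>. f (N \<omega>) \<omega> \<partial>M) = (\<Sum>k. \<integral>\<omega>. indicat_real {k} (N \<omega>) *\<^sub>R f k \<omega> \<partial>M)"
proof -
  have summ: "AE \<omega> in M. summable (\<lambda>k. norm (indicat_real {k} (N \<omega>) *\<^sub>R f k \<omega>))"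
  proof (rule AE_I2)
    fix \<omega>
    have "summable (\<lambda>k. indicator {k} (N \<omega>) *\<^sub>R norm (f k \<omega>))"
      by (rule sums_summable[OF sums_indicator_singleton])
    then show "summable (\<lambda>k. norm (indicat_real {k} (N \<omega>) *\<^sub>R f k \<omega>))"
      by simp
  qed
  have eq: "(\<Sum>k. indicat_real {k} (N \<omega>) *\<^sub>R f k \<omega>) = f (N \<omega>) \<omega>" for \<omega>
    using sums_indicator_singleton[of "N \<omega>" "\<lambda>k. f k \<omega>"] by (rule sums_unique[symmetric])
  show "integrable M (\<lambda>\<omega>. f (N \<omega>) \<omega>)"
    using integrable_suminf[OF int summ sum] unfolding eq .
  show "(\<integral>\<omega>. f (N \<omega>) \<omega> \<partial>M) = (\<Sum>k. \<integral>\<omega>. indicat_real {k} (N \<omega>) *\<^sub>R f k \<omega> \<partial>M)"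
    using integral_suminf[OF int summ sum] unfolding eq .
qed

text \<open>Joint independence is encoded by one family over \<open>nat option\<close>, with
  \<open>None\<close> standing for \<open>N\<close>; the cast to \<open>real\<close> gives all
  members the same target space. It yields independence among the summands and of \<open>N\<close>
  from the whole sequence.\<close>

locale poisson_sum = prob_space M for M :: "'a measure" +
  fixes X :: "nat \<Rightarrow> 'a \<Rightarrow> real" and N :: "'a \<Rightarrow> nat" and lam :: real
  assumes X_rv [measurable]: "\<And>i. X i \<in> borel_measurable M"
    and N_rv [measurable]: "N \<in> measurable M (count_space UNIV)"
    and ident: "\<And>i. distr M borel (X i) = distr M borel (X 0)"
    and indep: "indep_vars (\<lambda>_. borel)
      (\<lambda>j \<omega>. case j of None \<Rightarrow> real (N \<omega>) | Some i \<Rightarrow> X i \<omega>) UNIV"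
    and lam_pos: "lam > 0"
    and poisson: "\<And>k. prob {\<omega> \<in> space M. N \<omega> = k} = lam ^ k / fact k * exp (- lam)"
begin

definition S :: "'a \<Rightarrow> real" where "S \<omega> = (\<Sum>i<N \<omega>. X i \<omega>)"

lemma S_measurable [measurable]: "S \<in> borel_measurable M"
  unfolding S_def[abs_def]
  by (rule measurable_compose_countable[where f = "\<lambda>n \<omega>. \<Sum>i<n. X i \<omega>" and g = N]) simp_all

lemma indicator_N: "indicat_real {real k} (real (N \<omega>)) = indicat_real {k} (N \<omega>)"
  by (simp add: indicator_def)

lemma integrable_indicator_N: "integrable M (\<lambda>\<omega>. indicat_real {k} (N \<omega>))"
proof (rule integrable_const_bound[of _ 1])
  show "(\<lambda>\<omega>. indicat_real {k} (N \<omega>)) \<in> borel_measurable M"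
    by (rule measurable_compose[OF N_rv]) simp
qed (simp add: indicator_def)

lemma integral_indicator_N: "(\<integral>\<omega>. indicat_real {k} (N \<omega>) \<partial>M) = lam ^ k / fact k * exp (- lam)"
proof -
  have "(\<integral>\<omega>. indicat_real {k} (N \<omega>) \<partial>M) = (\<integral>\<omega>. indicat_real {\<omega> \<in> space M. N \<omega> = k} \<omega> \<partial>M)"
    by (intro Bochner_Integration.integral_cong refl) (simp add: indicator_def)
  also have "\<dots> = prob ({\<omega> \<in> space M. N \<omega> = k} \<inter> space M)"
    by (rule Bochner_Integration.integral_indicator)
  also have "{\<omega> \<in> space M. N \<omega> = k} \<inter> space M = {\<omega> \<in> space M. N \<omega> = k}" by blast
  finally show ?thesis unfolding poisson .
qed

lemma integral_comp_X:
  fixes f :: "real \<Rightarrow> 'b::{banach, second_countable_topology}"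
  assumes f: "f \<in> borel_measurable borel"
  shows "(\<integral>\<omega>. f (X i \<omega>) \<partial>M) = (\<integral>\<omega>. f (X 0 \<omega>) \<partial>M)"
proof -
  have "(\<integral>\<omega>. f (X i \<omega>) \<partial>M) = integral\<^sup>L (distr M borel (X i)) f"
    by (rule integral_distr[OF X_rv f, symmetric])
  also have "\<dots> = integral\<^sup>L (distr M borel (X 0)) f"
    by (simp only: ident[of i])
  also have "\<dots> = (\<integral>\<omega>. f (X 0 \<omega>) \<partial>M)"
    by (rule integral_distr[OF X_rv f])
  finally show ?thesis .
qed

lemma integrable_X:
  assumes "integrable M (X 0)"
  shows "integrable M (X i)"
proof -
  have "integrable M (X j) \<longleftrightarrow> integrable (distr M borel (X j)) (\<lambda>x. x)" for j
    by (rule integrable_distr_eq[OF X_rv, symmetric]) simp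
  note * = this[of i] this[of 0]
  show ?thesis
    unfolding *(1) ident[of i] by (rule assms[unfolded *(2)])
qed

text \<open>Only the members \<open>None\<close> and \<open>Some i\<close> of the family enter;
  after composition with an indicator and with the absolute value the expectation of their product
  factorises.\<close>

lemma integral_indicator_N_times_X:
  assumes "integrable M (X 0)"
  shows "integrable M (\<lambda>\<omega>. indicat_real {k} (N \<omega>) * \<bar>X i \<omega>\<bar>)"
    and "(\<integral>\<omega>. indicat_real {k} (N \<omega>) * \<bar>X i \<omega>\<bar> \<partial>M) = lam ^ k / fact k * exp (- lam) * (\<integral>\<omega>. \<bar>X 0 \<omega>\<bar> \<partial>M)"
proof -
  define Y where "Y j = (case j of None \<Rightarrow> indicat_real {real k} | Some (i::nat) \<Rightarrow> abs)" for j
  define Z where "Z = (\<lambda>j \<omega>. Y j (case j of None \<Rightarrow> real (N \<omega>) | Some i \<Rightarrow> X i \<omega>))"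
  have "indep_vars (\<lambda>_. borel) (\<lambda>j \<omega>. Y j (case j of None \<Rightarrow> real (N \<omega>) | Some i \<Rightarrow> X i \<omega>)) {None, Some i}"
    by (rule indep_vars_compose2[OF indep_vars_subset[OF indep subset_UNIV], where Y = Y and N = "\<lambda>_. borel"])
        (simp add: Y_def split: option.split)
  then have ind: "indep_vars (\<lambda>_. borel) Z {None, Some i}" by (simp only: Z_def)
  have int: "integrable M (Z j)" if "j \<in> {None, Some i}" for j
    using that integrable_X[OF assms, of i] integrable_indicator_N[of k]
    by (cases j) (simp_all add: Z_def Y_def indicator_N)
  note * = indep_vars_integrable[OF _ ind int] indep_vars_lebesgue_integral[OF _ ind int]
  show "integrable M (\<lambda>\<omega>. indicat_real {k} (N \<omega>) * \<bar>X i \<omega>\<bar>)"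
    using *(1) by (simp add: Z_def Y_def indicator_N)
  show "(\<integral>\<omega>. indicat_real {k} (N \<omega>) * \<bar>X i \<omega>\<bar> \<partial>M) = lam ^ k / fact k * exp (- lam) * (\<integral>\<omega>. \<bar>X 0 \<omega>\<bar> \<partial>M)"
    using *(2) integral_comp_X[of abs i] by (simp add: Z_def Y_def indicator_N integral_indicator_N)
qed

text \<open>Since k/k! = 1/(k - 1)!, the series shifted by one index is a multiple of the
  exponential series.\<close>

lemma summable_poisson_mean: "summable (\<lambda>k. real k * (lam ^ k / fact k * c))"
proof -
  have "summable (\<lambda>k. lam * c * (inverse (fact k) * lam ^ k))"
    by (intro summable_mult summable_exp)
  moreover have "real (Suc k) * (lam ^ Suc k / fact (Suc k) * c) = lam * c * (inverse (fact k) * lam ^ k)" for k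
  proof -
    have "fact (Suc k) = real (Suc k) * fact k" by simp
    then have "real (Suc k) / fact (Suc k) = inverse (fact k)"
      by (simp only: divide_inverse inverse_mult_distrib) simp
    moreover have "real (Suc k) * (lam ^ Suc k / fact (Suc k) * c) = real (Suc k) / fact (Suc k) * (lam ^ Suc k * c)"
      by (simp only: times_divide_eq_right times_divide_eq_left mult.assoc)
    ultimately show ?thesis by simp
  qed
  ultimately have "summable (\<lambda>k. real (Suc k) * (lam ^ Suc k / fact (Suc k) * c))" by simp
  then show ?thesis by (subst (asm) summable_Suc_iff)
qed

text \<open>This supplies the first moment that the Fejer smoothing asks for. On
  \<open>N = k\<close> the absolute sum has expectation at most k times the Poisson weight times
  that of |\<open>X 0\<close>|.\<close>

lemma integrable_S:
  assumes X0: "integrable M (X 0)"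
  shows "integrable M S"
proof -
  define m where "m = (\<integral>\<omega>. \<bar>X 0 \<omega>\<bar> \<partial>M)"
  define f where "f k \<omega> = (\<Sum>i<k. X i \<omega>)" for k \<omega>
  have bnd: "norm (indicat_real {k} (N \<omega>) *\<^sub>R f k \<omega>) \<le> (\<Sum>i<k. indicat_real {k} (N \<omega>) * \<bar>X i \<omega>\<bar>)" for k \<omega>
    using sum_abs[of "\<lambda>i. X i \<omega>" "{..<k}"] by (auto simp: f_def indicator_def)
  have int': "integrable M (\<lambda>\<omega>. \<Sum>i<k. indicat_real {k} (N \<omega>) * \<bar>X i \<omega>\<bar>)" for k
    by (intro Bochner_Integration.integrable_sum integral_indicator_N_times_X(1)[OF X0])
  have int: "integrable M (\<lambda>\<omega>. indicat_real {k} (N \<omega>) *\<^sub>R f k \<omega>)" for k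
  proof (rule Bochner_Integration.integrable_bound[OF int'])
    show "(\<lambda>\<omega>. indicat_real {k} (N \<omega>) *\<^sub>R f k \<omega>) \<in> borel_measurable M"
      using borel_measurable_integrable[OF integrable_indicator_N] unfolding f_def by measurable
    show "AE \<omega> in M. norm (indicat_real {k} (N \<omega>) *\<^sub>R f k \<omega>)
        \<le> norm (\<Sum>i<k. indicat_real {k} (N \<omega>) * \<bar>X i \<omega>\<bar>)"
    proof (rule AE_I2)
      fix \<omega>
      show "norm (indicat_real {k} (N \<omega>) *\<^sub>R f k \<omega>) \<le> norm (\<Sum>i<k. indicat_real {k} (N \<omega>) * \<bar>X i \<omega>\<bar>)"
        unfolding real_norm_def[of "sum _ _"] by (rule order_trans[OF bnd abs_ge_self])
    qed
  qed
  have "(\<integral>\<omega>. norm (indicat_real {k} (N \<omega>) *\<^sub>R f k \<omega>) \<partial>M) \<le> real k * (lam ^ k / fact k * (exp (- lam) * m))" for k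
  proof -
    have "(\<integral>\<omega>. norm (indicat_real {k} (N \<omega>) *\<^sub>R f k \<omega>) \<partial>M)
        \<le> (\<integral>\<omega>. (\<Sum>i<k. indicat_real {k} (N \<omega>) * \<bar>X i \<omega>\<bar>) \<partial>M)"
      by (intro integral_mono integrable_norm int int' bnd)
    also have "\<dots> = (\<Sum>i<k. lam ^ k / fact k * exp (- lam) * m)"
      using integral_indicator_N_times_X[OF X0]
      by (subst Bochner_Integration.integral_sum) (auto simp: m_def)
    finally show ?thesis by (simp add: mult_ac)
  qed
  then have "summable (\<lambda>k. \<integral>\<omega>. norm (indicat_real {k} (N \<omega>) *\<^sub>R f k \<omega>) \<partial>M)"
    by (intro summable_comparison_test'[OF summable_poisson_mean]) auto
  from integrable_random_index[OF int this] show ?thesis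
    by (simp add: f_def S_def[abs_def])
qed

text \<open>On \<open>N = k\<close> independence gives the Poisson weight times the k-th power of
  the characteristic function of one summand, and the sum over k is an exponential series. The
  exponentials have modulus 1, so the norms sum like the Poisson weights.\<close>

lemma char_scaled_S:
  "char (distr M borel (\<lambda>\<omega>. c * S \<omega>)) t = exp (lam * (char (distr M borel (\<lambda>\<omega>. c * X 0 \<omega>)) t - 1))"
proof -
  define \<phi> where "\<phi> = char (distr M borel (\<lambda>\<omega>. c * X 0 \<omega>)) t"
  have \<phi>: "\<phi> = (\<integral>\<omega>. iexp (t * (c * X 0 \<omega>)) \<partial>M)"
    unfolding \<phi>_def char_def by (rule integral_distr) auto
  define f where "f k \<omega> = iexp (t * (c * (\<Sum>i<k. X i \<omega>)))" for k \<omega>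
  have part: "integrable M (\<lambda>\<omega>. indicat_real {k} (N \<omega>) *\<^sub>R f k \<omega>) \<and>
      (\<integral>\<omega>. indicat_real {k} (N \<omega>) *\<^sub>R f k \<omega> \<partial>M) = (lam ^ k / fact k * exp (- lam)) *\<^sub>R \<phi> ^ k" for k
  proof -
    define Y where "Y j = (case j of None \<Rightarrow> (\<lambda>x. complex_of_real (indicat_real {real k} x))
      | Some (i::nat) \<Rightarrow> (\<lambda>x. iexp (t * (c * x))))" for j
    define Z where "Z = (\<lambda>j \<omega>. Y j (case j of None \<Rightarrow> real (N \<omega>) | Some i \<Rightarrow> X i \<omega>))"
    define J where "J = insert None (Some ` {..<k})"
    have J: "finite J" by (simp add: J_def)
    have "indep_vars (\<lambda>_. borel) (\<lambda>j \<omega>. Y j (case j of None \<Rightarrow> real (N \<omega>) | Some i \<Rightarrow> X i \<omega>)) J"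
      by (rule indep_vars_compose2[OF indep_vars_subset[OF indep subset_UNIV], where Y = Y and N = "\<lambda>_. borel"])
        (simp add: Y_def split: option.split)
    then have ind: "indep_vars (\<lambda>_. borel) Z J" by (simp only: Z_def)
    have Z_None: "Z None = (\<lambda>\<omega>. complex_of_real (indicat_real {k} (N \<omega>)))"
      by (simp add: Z_def Y_def indicator_N)
    have Z_Some: "Z (Some i) = (\<lambda>\<omega>. iexp (t * (c * X i \<omega>)))" for i
      by (simp add: Z_def Y_def)
    have int: "integrable M (Z j)" for j
    proof (cases j)
      case None
      have "integrable M (\<lambda>\<omega>. complex_of_real (indicat_real {k} (N \<omega>)))"
        using integrable_indicator_N by (rule integrable_of_real)
      then show ?thesis unfolding None Z_None .
    next
      case (Some i)
      show ?thesis unfolding Some Z_Some by (rule integrable_iexp) auto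
    qed
    have prod: "(\<Prod>j\<in>J. h j) = h None * (\<Prod>i<k. h (Some i))" for h :: "nat option \<Rightarrow> complex"
      unfolding J_def by (subst prod.insert) (auto simp: prod.reindex)
    have prodZ: "(\<Prod>j\<in>J. Z j \<omega>) = indicat_real {k} (N \<omega>) *\<^sub>R f k \<omega>" for \<omega>
    proof -
      have "(\<Prod>i<k. Z (Some i) \<omega>) = f k \<omega>"
        by (simp add: Z_Some f_def exp_sum[symmetric] sum_distrib_left)
      then show ?thesis unfolding prod by (simp add: Z_None scaleR_conv_of_real)
    qed
    have EX: "(\<integral>\<omega>. Z (Some i) \<omega> \<partial>M) = \<phi>" for i
      unfolding Z_Some \<phi> by (rule integral_comp_X) measurable
    have EN: "(\<integral>\<omega>. Z None \<omega> \<partial>M) = of_real (lam ^ k / fact k * exp (- lam))"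
      unfolding Z_None by (simp only: integral_complex_of_real integral_indicator_N)
    have "integrable M (\<lambda>\<omega>. \<Prod>j\<in>J. Z j \<omega>)" "(\<integral>\<omega>. (\<Prod>j\<in>J. Z j \<omega>) \<partial>M) = (\<Prod>j\<in>J. \<integral>\<omega>. Z j \<omega> \<partial>M)"
      using indep_vars_integrable[OF J ind int] indep_vars_lebesgue_integral[OF J ind int] by auto
    then show ?thesis
      unfolding prodZ prod EX EN by (simp add: scaleR_conv_of_real)
  qed
  have norm_eq: "(\<integral>\<omega>. norm (indicat_real {k} (N \<omega>) *\<^sub>R f k \<omega>) \<partial>M) = exp (- lam) * (inverse (fact k) * lam ^ k)" for k
    using integral_indicator_N[of k] by (simp add: f_def field_simps)
  have summ: "summable (\<lambda>k. \<integral>\<omega>. norm (indicat_real {k} (N \<omega>) *\<^sub>R f k \<omega>) \<partial>M)"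
    unfolding norm_eq by (intro summable_mult summable_exp)
  have "char (distr M borel (\<lambda>\<omega>. c * S \<omega>)) t = (\<integral>\<omega>. iexp (t * (c * S \<omega>)) \<partial>M)"
    unfolding char_def by (rule integral_distr) auto
  also have "\<dots> = (\<integral>\<omega>. f (N \<omega>) \<omega> \<partial>M)"
    by (simp add: f_def S_def)
  also have "\<dots> = (\<Sum>k. (lam ^ k / fact k * exp (- lam)) *\<^sub>R \<phi> ^ k)"
    using integral_random_index[OF _ summ] part by simp
  also have "\<dots> = (\<Sum>k. of_real (exp (- lam)) * ((of_real lam * \<phi>) ^ k /\<^sub>R fact k))"
  proof -
    have "(lam ^ k / fact k * exp (- lam)) *\<^sub>R \<phi> ^ k
        = of_real (exp (- lam)) * ((of_real lam * \<phi>) ^ k /\<^sub>R fact k)" for k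
      by (simp add: scaleR_conv_of_real power_mult_distrib divide_inverse del: of_real_exp)
    then show ?thesis by simp
  qed
  also have "\<dots> = of_real (exp (- lam)) * exp (of_real lam * \<phi>)"
    by (rule sums_unique[OF sums_mult[OF exp_converges], symmetric])
  also have "\<dots> = exp (of_real lam * (\<phi> - 1))"
    by (simp add: exp_of_real[symmetric] exp_add[symmetric] algebra_simps)
  finally show ?thesis by (simp add: \<phi>_def)
qed

end

section \<open>Bounds for the characteristic function\<close>

text \<open>Real parts of the Taylor remainders of exp(ix) of orders 1 and 3; the odd terms of the
  polynomials are imaginary and drop out.\<close>

lemma cos_taylor_bounds:
  fixes x :: real
  shows "1 - x\<^sup>2 / 2 \<le> cos x" and "cos x \<le> 1 - x\<^sup>2 / 2 + x ^ 4 / 24"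
proof -
  have "\<bar>Re (iexp x - (\<Sum>k\<le>1. (\<i> * x) ^ k / fact k))\<bar> \<le> \<bar>x\<bar> ^ Suc 1 / fact (Suc 1)"
    by (rule order_trans[OF abs_Re_le_cmod iexp_approx1])
  then show "1 - x\<^sup>2 / 2 \<le> cos x"
    by (simp add: Re_exp power2_eq_square abs_le_iff)
  have "Re (iexp x - (\<Sum>k\<le>3. (\<i> * x) ^ k / fact k)) \<le> \<bar>x\<bar> ^ Suc 3 / fact (Suc 3)"
    by (rule order_trans[OF complex_Re_le_cmod iexp_approx1])
  then show "cos x \<le> 1 - x\<^sup>2 / 2 + x ^ 4 / 24"
    by (simp add: Re_exp eval_nat_numeral fact_numeral algebra_simps)
qed

lemma pi_bounds: "157 / 50 < pi" "pi < 63 / 20"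
proof -
  show "157 / 50 < pi" by (rule order_less_le_trans[OF _ pi_approx(1)]) simp
  show "pi < 63 / 20" by (rule order_le_less_trans[OF pi_approx(2)]) simp
qed

text \<open>The case split covers the region around \<open>\<pi>\<close>, where the cubic is closest to the cosine.\<close>

lemma one_minus_cos_ge_cubic:
  fixes x :: real
  shows "x\<^sup>2 / 2 - \<bar>x\<bar> ^ 3 / 9 \<le> 1 - cos x"
proof -
  have pos: "x\<^sup>2 / 2 - x ^ 3 / 9 \<le> 1 - cos x" if "0 \<le> x" for x :: real
  proof -
    consider "x \<le> 8 / 3" | "8 / 3 \<le> x" "x \<le> 4" | "4 \<le> x" "x \<le> 9 / 2" | "9 / 2 \<le> x" by linarith
    then show ?thesis
    proof cases
      case 1
      \<comment> \<open>As (8/3)/24 = 1/9, the quartic Taylor term stays below the cubic one up to x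
        = 8/3.\<close>
      have "x ^ 4 / 24 = x ^ 3 * x / 24" by (simp add: eval_nat_numeral)
      also have "\<dots> \<le> x ^ 3 * (8 / 3) / 24"
        using 1 that by (intro divide_right_mono mult_left_mono) auto
      finally show ?thesis using cos_taylor_bounds(2)[of x] by simp
    next
      case 4
      then have "x\<^sup>2 * (9 / 2) \<le> x\<^sup>2 * x" by (intro mult_left_mono) auto
      then have "x\<^sup>2 / 2 - x ^ 3 / 9 \<le> 0" by (simp add: power2_eq_square power3_eq_cube)
      then show ?thesis using cos_le_one[of x] by linarith
    next
      case 2
      \<comment> \<open>Expanding around pi gives 1 - cos x = 1 + cos(x - pi) \<ge> 2 - (x - pi)^2/2
        \<ge> 3/2. On x \<ge> 0 the cubic has its maximum 3/2 at x = 3, which the double root below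
        expresses.\<close>
      have "\<bar>x - pi\<bar> \<le> 1" using 2 pi_bounds by linarith
      then have "(x - pi)\<^sup>2 \<le> 1" by (simp add: abs_square_le_1)
      moreover have "0 \<le> (x - 3)\<^sup>2 * (x + 3 / 2)" using that by simp
      then have "x\<^sup>2 / 2 - x ^ 3 / 9 \<le> 3 / 2" by (simp add: power2_eq_square power3_eq_cube algebra_simps)
      ultimately show ?thesis using cos_taylor_bounds(1)[of "x - pi"] by simp
    next
      case 3
      \<comment> \<open>Here 34/25 = 9/2 - 157/50. The factor x - 4 below encodes that the cubic,
        decreasing past 3, is at most its value 8/9 at 4.\<close>
      have "(x - pi)\<^sup>2 \<le> (34 / 25)\<^sup>2" using 3 pi_bounds by (intro power_mono) linarith+
      then have "(x - pi)\<^sup>2 \<le> 1156 / 625" by (simp add: power2_eq_square)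
      moreover have "4 * 4 \<le> x * x" using 3 by (intro mult_mono) auto
      then have "0 \<le> (x - 4) * (x * x - x / 2 - 2)" using 3 by (intro mult_nonneg_nonneg) linarith+
      then have "x\<^sup>2 / 2 - x ^ 3 / 9 \<le> 8 / 9" by (simp add: power2_eq_square power3_eq_cube algebra_simps)
      ultimately show ?thesis using cos_taylor_bounds(1)[of "x - pi"] by simp
    qed
  qed
  show ?thesis using pos[of "\<bar>x\<bar>"] by simp
qed

text \<open>For |y| \<le> 1 the cubic bound applies, with t^3/9 = (t^2/2)(2t/9); for |y| > 1 the
  left-hand side is nonpositive. The maximum covers both ranges with the single weight y^2 min(1,
  |y|), ready for taking expectations.\<close>

lemma one_minus_cos_scaled_ge:
  fixes t y :: real
  assumes "0 < t"
  shows "t\<^sup>2 * y\<^sup>2 / 2 - t\<^sup>2 / 2 * max 1 (2 * t / 9) * (y\<^sup>2 * min 1 \<bar>y\<bar>) \<le> 1 - cos (t * y)"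
proof (cases "\<bar>y\<bar> \<le> 1")
  case True
  have "\<bar>t * y\<bar> ^ 3 / 9 = t\<^sup>2 / 2 * (2 * t / 9) * (y\<^sup>2 * \<bar>y\<bar>)"
    using assms by (simp add: abs_mult power_mult_distrib power3_eq_cube power2_eq_square)
  also have "\<dots> \<le> t\<^sup>2 / 2 * max 1 (2 * t / 9) * (y\<^sup>2 * \<bar>y\<bar>)"
    by (intro mult_right_mono mult_left_mono) auto
  finally show ?thesis
    using one_minus_cos_ge_cubic[of "t * y"] True by (simp add: power_mult_distrib)
next
  case False
  have "t\<^sup>2 / 2 * 1 * y\<^sup>2 \<le> t\<^sup>2 / 2 * max 1 (2 * t / 9) * y\<^sup>2"
    by (intro mult_right_mono mult_left_mono) auto
  then have "t\<^sup>2 * y\<^sup>2 / 2 - t\<^sup>2 / 2 * max 1 (2 * t / 9) * (y\<^sup>2 * min 1 \<bar>y\<bar>) \<le> 0"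
    using False by simp
  then show ?thesis using cos_le_one[of "t * y"] by linarith
qed

text \<open>The same weight arises from two forms of the Taylor remainder: |ty|^3/6 when |y| \<le>
  1, and |ty|^2 otherwise.\<close>

lemma iexp_taylor2_scaled:
  fixes t y :: real
  assumes "0 < t"
  shows "cmod (iexp (t * y) - (1 + \<i> * t * y - t\<^sup>2 * y\<^sup>2 / 2)) \<le> t\<^sup>2 * max 1 (t / 6) * (y\<^sup>2 * min 1 \<bar>y\<bar>)"
proof -
  have sum: "(\<Sum>k\<le>2. (\<i> * x) ^ k / fact k) = 1 + \<i> * x - x\<^sup>2 / 2" for x :: real
    by (simp add: numeral_2_eq_2 power2_eq_square) (simp add: algebra_simps)
  have T: "iexp (t * y) - (1 + \<i> * t * y - t\<^sup>2 * y\<^sup>2 / 2) = iexp (t * y) - (\<Sum>k\<le>2. (\<i> * (t * y)) ^ k / fact k)"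
    unfolding sum by (simp add: power_mult_distrib mult.assoc)
  show ?thesis
  proof (cases "\<bar>y\<bar> \<le> 1")
    case True
    have "cmod (iexp (t * y) - (\<Sum>k\<le>2. (\<i> * (t * y)) ^ k / fact k)) \<le> \<bar>t * y\<bar> ^ Suc 2 / fact (Suc 2)"
      by (rule iexp_approx1)
    also have "\<dots> = t\<^sup>2 * (t / 6) * (y\<^sup>2 * \<bar>y\<bar>)"
      using assms by (simp add: abs_mult power_mult_distrib eval_nat_numeral fact_numeral)
    also have "\<dots> \<le> t\<^sup>2 * max 1 (t / 6) * (y\<^sup>2 * \<bar>y\<bar>)"
      by (intro mult_right_mono mult_left_mono) auto
    finally show ?thesis unfolding T using True by simp
  next
    case False
    have "cmod (iexp (t * y) - (\<Sum>k\<le>2. (\<i> * (t * y)) ^ k / fact k)) \<le> 2 * \<bar>t * y\<bar> ^ 2 / fact 2"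
      by (rule iexp_approx2)
    also have "\<dots> = t\<^sup>2 * 1 * y\<^sup>2"
      by (simp add: power_mult_distrib)
    also have "\<dots> \<le> t\<^sup>2 * max 1 (t / 6) * y\<^sup>2"
      by (intro mult_right_mono mult_left_mono) auto
    finally show ?thesis unfolding T using False by simp
  qed
qed

text \<open>Mean value inequality on the half-plane Re z \<le> m, which is convex and on which the
  derivative of exp has modulus at most exp m.\<close>

lemma cmod_exp_diff_le:
  assumes "Re a \<le> m" "Re b \<le> m"
  shows "cmod (exp a - exp b) \<le> exp m * cmod (a - b)"
proof (rule field_differentiable_bound[where S = "{z. Re z \<le> m}"])
  show "convex {z. Re z \<le> m}" by (rule convex_halfspace_Re_le)
  show "(exp has_field_derivative exp z) (at z within {z. Re z \<le> m})" for z :: complex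
    by (rule DERIV_subset[OF DERIV_exp]) simp
qed (use assms in auto)

text \<open>Take expectations of the pointwise bounds and multiply by \<open>lam\<close>. Centring
  removes the linear Taylor term and lam E Y^2 = 1 turns the quadratic one into -t^2/2, so that
  \<open>d\<close> controls everything left over.\<close>

lemma (in prob_space)
  fixes Y :: "'a \<Rightarrow> real" and lam t d :: real and \<psi> :: complex
  assumes [measurable]: "Y \<in> borel_measurable M"
    and int: "integrable M Y" "integrable M (\<lambda>\<omega>. (Y \<omega>)\<^sup>2)"
    and mean: "expectation Y = 0" and var: "lam * expectation (\<lambda>\<omega>. (Y \<omega>)\<^sup>2) = 1"
    and "lam > 0" and t: "0 < t"
  defines "d \<equiv> lam * expectation (\<lambda>\<omega>. (Y \<omega>)\<^sup>2 * min 1 \<bar>Y \<omega>\<bar>)"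
    and "\<psi> \<equiv> lam * (char (distr M borel Y) t - 1)"
  shows char_exponent_close: "cmod (\<psi> - - t\<^sup>2 / 2) \<le> d * t\<^sup>2 * max 1 (t / 6)"
    and char_exponent_Re_le: "Re \<psi> \<le> - t\<^sup>2 / 2 * (1 - d * max 1 (2 * t / 9))"
proof -
  have char: "char (distr M borel Y) t = (\<integral>\<omega>. iexp (t * Y \<omega>) \<partial>M)"
    unfolding char_def by (rule integral_distr) auto
  have ie: "integrable M (\<lambda>\<omega>. iexp (t * Y \<omega>))"
    by (rule integrable_iexp) auto
  have im: "integrable M (\<lambda>\<omega>. (Y \<omega>)\<^sup>2 * min 1 \<bar>Y \<omega>\<bar>)"
    by (rule Bochner_Integration.integrable_bound[OF int(2)])
       (auto simp: abs_mult intro!: AE_I2 mult_left_le)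
  have i1: "integrable M (\<lambda>\<omega>. \<i> * t * complex_of_real (Y \<omega>))"
    using int(1) by (intro integrable_mult_right integrable_of_real)
  have i2: "integrable M (\<lambda>\<omega>. complex_of_real (t\<^sup>2 / 2) * complex_of_real ((Y \<omega>)\<^sup>2))"
    using int(2) by (intro integrable_mult_right integrable_of_real)
  define R where "R \<omega> = iexp (t * Y \<omega>) - (1 + \<i> * t * Y \<omega> - t\<^sup>2 * (Y \<omega>)\<^sup>2 / 2)" for \<omega>
  have R: "R = (\<lambda>\<omega>. iexp (t * Y \<omega>) - 1 - \<i> * t * complex_of_real (Y \<omega>)
      + complex_of_real (t\<^sup>2 / 2) * complex_of_real ((Y \<omega>)\<^sup>2))"
    by (simp add: R_def fun_eq_iff)
  have iR: "integrable M R"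
    unfolding R by (intro Bochner_Integration.integrable_add Bochner_Integration.integrable_diff ie i1 i2) simp
  have ER: "(\<integral>\<omega>. R \<omega> \<partial>M) = char (distr M borel Y) t - 1
      + complex_of_real (t\<^sup>2 / 2) * complex_of_real (expectation (\<lambda>\<omega>. (Y \<omega>)\<^sup>2))"
  proof -
    have "(\<integral>\<omega>. \<i> * t * complex_of_real (Y \<omega>) \<partial>M) = \<i> * t * complex_of_real (expectation Y)"
      by (simp only: integral_mult_right_zero integral_complex_of_real)
    moreover have "(\<integral>\<omega>. complex_of_real (t\<^sup>2 / 2) * complex_of_real ((Y \<omega>)\<^sup>2) \<partial>M)
        = complex_of_real (t\<^sup>2 / 2) * complex_of_real (expectation (\<lambda>\<omega>. (Y \<omega>)\<^sup>2))"
      by (simp only: integral_mult_right_zero integral_complex_of_real)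
    moreover have "(\<integral>\<omega>. R \<omega> \<partial>M) = (\<integral>\<omega>. iexp (t * Y \<omega>) \<partial>M) - (\<integral>\<omega>. 1 \<partial>M)
        - (\<integral>\<omega>. \<i> * t * complex_of_real (Y \<omega>) \<partial>M)
        + (\<integral>\<omega>. complex_of_real (t\<^sup>2 / 2) * complex_of_real ((Y \<omega>)\<^sup>2) \<partial>M)"
      unfolding R using ie i1 i2
      by (subst Bochner_Integration.integral_add Bochner_Integration.integral_diff;
          (intro Bochner_Integration.integrable_diff)?; simp)+
    ultimately show ?thesis by (simp add: char mean prob_space)
  qed
  have "\<psi> - - t\<^sup>2 / 2 = lam * (\<integral>\<omega>. R \<omega> \<partial>M)"
  proof -
    have "lam * (\<integral>\<omega>. R \<omega> \<partial>M) = \<psi> + complex_of_real (t\<^sup>2 / 2)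
        * complex_of_real (lam * expectation (\<lambda>\<omega>. (Y \<omega>)\<^sup>2))"
      unfolding ER \<psi>_def by (simp add: algebra_simps)
    then show ?thesis unfolding var by simp
  qed
  then have "cmod (\<psi> - - t\<^sup>2 / 2) = lam * cmod (\<integral>\<omega>. R \<omega> \<partial>M)"
    using \<open>lam > 0\<close> by (simp add: norm_mult)
  also have "cmod (\<integral>\<omega>. R \<omega> \<partial>M) \<le> (\<integral>\<omega>. cmod (R \<omega>) \<partial>M)"
    by (rule integral_norm_bound)
  also have "\<dots> \<le> (\<integral>\<omega>. t\<^sup>2 * max 1 (t / 6) * ((Y \<omega>)\<^sup>2 * min 1 \<bar>Y \<omega>\<bar>) \<partial>M)"
    using iexp_taylor2_scaled[OF t] unfolding R_def[symmetric]
    by (intro integral_mono integrable_norm iR integrable_mult_right im) (simp add: R_def)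
  finally show "cmod (\<psi> - - t\<^sup>2 / 2) \<le> d * t\<^sup>2 * max 1 (t / 6)"
    using \<open>lam > 0\<close> unfolding d_def integral_mult_right_zero by (simp add: mult_ac)
  have "integrable M (\<lambda>\<omega>. cos (t * Y \<omega>))"
    by (rule integrable_const_bound[of _ 1]) auto
  then have icos: "integrable M (\<lambda>\<omega>. 1 - cos (t * Y \<omega>))" by simp
  have "Re (char (distr M borel Y) t) = (\<integral>\<omega>. cos (t * Y \<omega>) \<partial>M)"
    unfolding char using ie by (subst integral_Re[symmetric]) (auto simp: Re_exp)
  moreover have "integrable M (\<lambda>\<omega>. cos (t * Y \<omega>))"
    by (rule integrable_const_bound[of _ 1]) auto
  ultimately have Re: "Re \<psi> = - lam * (\<integral>\<omega>. 1 - cos (t * Y \<omega>) \<partial>M)"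
    by (simp add: \<psi>_def prob_space algebra_simps)
  have i3: "integrable M (\<lambda>\<omega>. t\<^sup>2 * (Y \<omega>)\<^sup>2 / 2)"
    using int(2) by simp
  have i4: "integrable M (\<lambda>\<omega>. t\<^sup>2 / 2 * max 1 (2 * t / 9) * ((Y \<omega>)\<^sup>2 * min 1 \<bar>Y \<omega>\<bar>))"
    using im by (rule integrable_mult_right)
  have "(\<integral>\<omega>. t\<^sup>2 * (Y \<omega>)\<^sup>2 / 2 - t\<^sup>2 / 2 * max 1 (2 * t / 9) * ((Y \<omega>)\<^sup>2 * min 1 \<bar>Y \<omega>\<bar>) \<partial>M)
      \<le> (\<integral>\<omega>. 1 - cos (t * Y \<omega>) \<partial>M)"
    by (intro integral_mono icos Bochner_Integration.integrable_diff i3 i4 one_minus_cos_scaled_ge[OF t])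
  then have "t\<^sup>2 / 2 * expectation (\<lambda>\<omega>. (Y \<omega>)\<^sup>2)
      - t\<^sup>2 / 2 * max 1 (2 * t / 9) * expectation (\<lambda>\<omega>. (Y \<omega>)\<^sup>2 * min 1 \<bar>Y \<omega>\<bar>) \<le> (\<integral>\<omega>. 1 - cos (t * Y \<omega>) \<partial>M)"
    by (subst (asm) Bochner_Integration.integral_diff[OF i3 i4]) simp
  from mult_left_mono[OF this, of lam] \<open>lam > 0\<close>
  have "t\<^sup>2 / 2 * (lam * expectation (\<lambda>\<omega>. (Y \<omega>)\<^sup>2)) - t\<^sup>2 / 2 * max 1 (2 * t / 9) * d
      \<le> lam * (\<integral>\<omega>. 1 - cos (t * Y \<omega>) \<partial>M)"
    by (simp only: d_def right_diff_distrib mult_ac less_imp_le)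
  then show "Re \<psi> \<le> - t\<^sup>2 / 2 * (1 - d * max 1 (2 * t / 9))"
    unfolding var Re by (simp add: algebra_simps)
qed

text \<open>The frequency 9/2 is where 2t/9 reaches 1. Below it both maxima equal 1 and the decay is
  exp(-(1 - d)t^2/2); above it \<open>t * d \<le> 3\<close> guarantees exp(-t^2/6). The first term
  is kept beyond 9/2 as well, which leaves a single indicator.\<close>

lemma (in prob_space) char_compound_poisson_diff_le:
  fixes Y :: "'a \<Rightarrow> real" and lam t d :: real
  assumes Y: "Y \<in> borel_measurable M" "integrable M Y" "integrable M (\<lambda>\<omega>. (Y \<omega>)\<^sup>2)"
    "expectation Y = 0" "lam * expectation (\<lambda>\<omega>. (Y \<omega>)\<^sup>2) = 1" "lam > 0"
    and d: "d = lam * expectation (\<lambda>\<omega>. (Y \<omega>)\<^sup>2 * min 1 \<bar>Y \<omega>\<bar>)"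
    and t: "0 < t" "t * d \<le> 3"
  shows "cmod (exp (lam * (char (distr M borel Y) t - 1)) - exp (- t\<^sup>2 / 2))
    \<le> d * t\<^sup>2 * (exp (- ((1 - d) / 2) * t\<^sup>2) + indicator {9 / 2..} t * exp (- 1 / 2 - 23 / 162 * t\<^sup>2))"
proof -
  define \<psi> where "\<psi> = lam * (char (distr M borel Y) t - 1)"
  define m where "m = - t\<^sup>2 / 2 * (1 - d * max 1 (2 * t / 9))"
  have "0 \<le> expectation (\<lambda>\<omega>. (Y \<omega>)\<^sup>2 * min 1 \<bar>Y \<omega>\<bar>)" by (intro integral_nonneg_AE) auto
  then have d0: "0 \<le> d" using \<open>lam > 0\<close> by (simp add: d)
  have close: "cmod (\<psi> - - t\<^sup>2 / 2) \<le> d * t\<^sup>2 * max 1 (t / 6)"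
    unfolding \<psi>_def d by (rule char_exponent_close[OF Y t(1)])
  have Re: "Re \<psi> \<le> m"
    unfolding \<psi>_def d m_def by (rule char_exponent_Re_le[OF Y t(1)])
  have "- t\<^sup>2 / 2 \<le> m"
    unfolding m_def using d0 by (simp add: mult_nonneg_nonneg right_diff_distrib)
  then have Re': "Re (complex_of_real (- t\<^sup>2 / 2)) \<le> m" by (simp only: Re_complex_of_real)
  have "cmod (exp \<psi> - exp (- t\<^sup>2 / 2)) \<le> exp m * cmod (\<psi> - - t\<^sup>2 / 2)"
    using cmod_exp_diff_le[OF Re Re'] by (simp only: exp_of_real)
  also have "\<dots> \<le> exp m * (d * t\<^sup>2 * max 1 (t / 6))"
    using close by (intro mult_left_mono) auto
  also have "\<dots> = d * t\<^sup>2 * (max 1 (t / 6) * exp m)" by (simp add: mult_ac)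
  also have "\<dots> \<le> d * t\<^sup>2 * (exp (- ((1 - d) / 2) * t\<^sup>2) + indicator {9 / 2..} t * exp (- 1 / 2 - 23 / 162 * t\<^sup>2))"
  proof (intro mult_left_mono)
    show "max 1 (t / 6) * exp m
        \<le> exp (- ((1 - d) / 2) * t\<^sup>2) + indicator {9 / 2..} t * exp (- 1 / 2 - 23 / 162 * t\<^sup>2)"
    proof (cases "t < 9 / 2")
      case True
      then have "max 1 (t / 6) = 1" "max 1 (2 * t / 9) = 1" by auto
      then show ?thesis using True by (simp add: m_def mult_ac)
    next
      case False
      have "max 1 (2 * t / 9) = 2 * t / 9" using False by auto
      then have "m = - t\<^sup>2 / 2 * (1 - t * d * (2 / 9))" by (simp add: m_def mult_ac)
      also have "\<dots> \<le> - t\<^sup>2 / 2 * (1 - 3 * (2 / 9))"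
        using t(2) by (intro mult_left_mono_neg) (auto simp: mult.commute[of t d])
      finally have m: "m \<le> - t\<^sup>2 / 6" by simp
      \<comment> \<open>With u = 2t/9 one has u \<le> 1 + (u^2 - 1)/2 \<le> exp((u^2 - 1)/2). This
        moves the linear factor into the exponent, where 2/81 - 1/6 = -23/162.\<close>
      have "max 1 (t / 6) \<le> t / (9 / 2)" using False by simp
      also have "\<dots> \<le> 1 + (t\<^sup>2 * (2 / 81) - 1 / 2)"
        using zero_le_power2[of "t / (9 / 2) - 1"] by (simp add: power2_eq_square algebra_simps)
      also have "\<dots> \<le> exp (t\<^sup>2 * (2 / 81) - 1 / 2)" by (rule exp_ge_add_one_self)
      finally have "max 1 (t / 6) * exp m \<le> exp (t\<^sup>2 * (2 / 81) - 1 / 2) * exp (- t\<^sup>2 / 6)"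
        using m by (intro mult_mono) auto
      also have "\<dots> = exp (- 1 / 2 - 23 / 162 * t\<^sup>2)"
        by (simp add: exp_add[symmetric])
      finally show ?thesis using False by (simp add: add_increasing)
    qed
  qed (use d0 in simp)
  finally show ?thesis unfolding \<psi>_def .
qed

section \<open>Evaluation of the smoothing integral and of the constant\<close>

lemma gaussian_tail_integrals:
  fixes T s :: real
  assumes "T \<ge> 9 / 2" "s > 0"
  defines "h \<equiv> \<lambda>t. 3 * (T * t) * (exp (- (s / 2) * (T * t)\<^sup>2)
    + indicator {9 / 2..} (T * t) * exp (- 1 / 2 - 23 / 162 * (T * t)\<^sup>2))"
  shows "set_integrable lborel {0..1} h"
    and "(LBINT t:{0..1}. h t) \<le> 3 / T * (1 / s + 81 / 23 * exp (- (27 / 8)))"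
proof -
  \<comment> \<open>The point where T t reaches 9/2; the lower bound on \<open>T\<close> places it
    in [0, 1]. Thanks to the factor t in front of the exponentials, both pieces have elementary
    antiderivatives.\<close>
  define c where "c = 9 / 2 / T"
  have T: "T > 0" using assms by simp
  have c: "0 \<le> c" "c \<le> 1" using assms by (auto simp: c_def)
  define f1 where "f1 t = 3 * (T * t) * exp (- (s / 2) * (T * t)\<^sup>2)" for t
  define f2 where "f2 t = 3 * (T * t) * exp (- 1 / 2 - 23 / 162 * (T * t)\<^sup>2)" for t
  define F1 where "F1 t = - (3 / (s * T)) * exp (- (s / 2) * (T * t)\<^sup>2)" for t
  define F2 where "F2 t = - (3 * 81 / (23 * T)) * exp (- 1 / 2 - 23 / 162 * (T * t)\<^sup>2)" for t
  have "has_bochner_integral lborel (\<lambda>t. f1 t * indicator {0..1} t) (F1 1 - F1 0)"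
  proof (rule has_bochner_integral_FTC_Icc_real)
    show "DERIV F1 x :> f1 x" for x
      unfolding F1_def f1_def using T \<open>s > 0\<close>
      by (auto intro!: derivative_eq_intros simp: field_simps power2_eq_square)
    show "isCont f1 x" for x unfolding f1_def by (intro continuous_intros)
  qed simp
  moreover have "has_bochner_integral lborel (\<lambda>t. f2 t * indicator {c..1} t) (F2 1 - F2 c)"
  proof (rule has_bochner_integral_FTC_Icc_real)
    show "DERIV F2 x :> f2 x" for x
      unfolding F2_def f2_def using T
      by (auto intro!: derivative_eq_intros simp: field_simps power2_eq_square)
    show "isCont f2 x" for x unfolding f2_def by (intro continuous_intros)
  qed (use c in simp)
  ultimately have "has_bochner_integral lborel
      (\<lambda>t. f1 t * indicator {0..1} t + f2 t * indicator {c..1} t) ((F1 1 - F1 0) + (F2 1 - F2 c))"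
    by (rule has_bochner_integral_add)
  moreover have "(\<lambda>t. f1 t * indicator {0..1} t + f2 t * indicator {c..1} t) = (\<lambda>t. indicator {0..1} t *\<^sub>R h t)"
  proof
    fix t
    have "9 / 2 \<le> T * t \<longleftrightarrow> c \<le> t" using T by (simp add: c_def field_simps)
    then have i: "indicat_real {9 / 2..} (T * t) = indicat_real {c..} t"
      by (simp only: indicator_def atLeast_iff)
    show "f1 t * indicator {0..1} t + f2 t * indicator {c..1} t = indicator {0..1} t *\<^sub>R h t"
      unfolding h_def i f1_def f2_def using c by (auto simp: distrib_left split: split_indicator)
  qed
  ultimately have *: "has_bochner_integral lborel (\<lambda>t. indicator {0..1} t *\<^sub>R h t) ((F1 1 - F1 0) + (F2 1 - F2 c))"
    by simp
  show "set_integrable lborel {0..1} h"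
    using * unfolding set_integrable_def by (rule integrable.intros)
  \<comment> \<open>At this point the exponent is -1/2 - (23/162)(81/4) = -1/2 - 23/8 =
    -27/8.\<close>
  have "T * c = 9 / 2" using T by (simp add: c_def)
  then have "F2 c = - (3 * 81 / (23 * T)) * exp (- (27 / 8))"
    unfolding F2_def by (simp only: power2_eq_square) simp
  moreover have "F1 1 \<le> 0" "F2 1 \<le> 0" using T \<open>s > 0\<close> by (auto simp: F1_def F2_def)
  moreover have "F1 0 = - (3 / (s * T))" by (simp add: F1_def)
  ultimately have "(F1 1 - F1 0) + (F2 1 - F2 c) \<le> 3 / (s * T) + 3 * 81 / (23 * T) * exp (- (27 / 8))"
    by simp
  also have "\<dots> = 3 / T * (1 / s + 81 / 23 * exp (- (27 / 8)))"
    using T \<open>s > 0\<close> by (simp add: field_simps)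
  finally show "(LBINT t:{0..1}. h t) \<le> 3 / T * (1 / s + 81 / 23 * exp (- (27 / 8)))"
    using has_bochner_integral_integral_eq[OF *] by (simp add: set_lebesgue_integral_def)
qed

lemma numeric_constant_bound:
  fixes K d :: real
  assumes K: "K * (1 - 8 / (3 * pi\<^sup>2)) \<le> d * (1 / (1 - d) + 81 / 23 * exp (- (27 / 8))) / pi
      + d / (3 * sqrt (2 * pi)) * (3 * pi / 2) * (1 - 4 / (3 * pi\<^sup>2))"
    and d: "0 < d" "d \<le> 5392 / 10000" and "0 \<le> K"
  shows "K \<le> 1.8546 * d"
proof -
  \<comment> \<open>Uses e \<ge> 1 + 1 + 1/2 and 27/8 \<ge> 3.\<close>
  have "(5 / 2) ^ 3 \<le> exp (1 :: real) ^ 3"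
    using exp_lower_Taylor_quadratic[of 1] by (intro power_mono) auto
  also have "\<dots> = exp 3" by (simp add: exp_of_nat_mult[symmetric])
  also have "\<dots> \<le> exp (27 / 8)" by simp
  finally have "125 / 8 \<le> exp (27 / 8 :: real)" by (simp add: eval_nat_numeral)
  then have e: "exp (- (27 / 8)) \<le> (8 / 125 :: real)"
    using le_imp_inverse_le[of "125 / 8" "exp (27 / 8 :: real)"] by (simp add: exp_minus)
  \<comment> \<open>The denominator is 1 - d at the largest admissible value d = 0.5392.\<close>
  have "1 / (1 - d) \<le> 1 / (4608 / 10000)"
    using d by (intro divide_left_mono) auto
  with e have J: "1 / (1 - d) + 81 / 23 * exp (- (27 / 8)) \<le> (23957 / 10000)" by simp
  have pi2: "(157 / 50)\<^sup>2 \<le> pi\<^sup>2" "pi\<^sup>2 \<le> (63 / 20)\<^sup>2"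
    using pi_bounds by (intro power_mono; simp)+
  have "8 / (3 * pi\<^sup>2) \<le> 8 / (3 * (157 / 50)\<^sup>2)"
    using pi2 by (intro divide_left_mono) auto
  then have low: "7295 / 10000 \<le> 1 - 8 / (3 * pi\<^sup>2)" by (simp add: power2_eq_square)
  have "4 / (3 * (63 / 20)\<^sup>2) \<le> 4 / (3 * pi\<^sup>2)"
    using pi2 by (intro divide_left_mono) auto
  then have up: "1 - 4 / (3 * pi\<^sup>2) \<le> 8657 / 10000" by (simp add: power2_eq_square)
  have "4 / (3 * pi\<^sup>2) \<le> 8 / (3 * pi\<^sup>2)" by (intro divide_right_mono) auto
  with low have nonneg: "0 \<le> 1 - 4 / (3 * pi\<^sup>2)" by linarith
  \<comment> \<open>Follows from 6.28 \<ge> 6.25. With pi < 63/20 it gives the coefficient (63/20)/5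
    = 63/100 below.\<close>
  have "5 / 2 \<le> sqrt (2 * pi)"
    using pi_bounds by (intro real_le_rsqrt) (simp add: power2_eq_square)
  then have "d / (3 * sqrt (2 * pi)) * (3 * pi / 2) \<le> d / (3 * (5 / 2)) * (3 * (63 / 20) / 2)"
    using pi_bounds d by (intro mult_mono divide_left_mono divide_right_mono) auto
  then have L: "d / (3 * sqrt (2 * pi)) * (3 * pi / 2) \<le> d * (63 / 100)" by simp
  have "d * (1 / (1 - d) + 81 / 23 * exp (- (27 / 8))) / pi \<le> d * (23957 / 10000) / (157 / 50)"
    using J d pi_bounds by (intro frac_le mult_left_mono) auto
  moreover have "d / (3 * sqrt (2 * pi)) * (3 * pi / 2) * (1 - 4 / (3 * pi\<^sup>2)) \<le> d * (63 / 100) * (8657 / 10000)"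
    using d by (intro mult_mono[OF L up _ nonneg]) simp
  moreover have "K * (7295 / 10000) \<le> K * (1 - 8 / (3 * pi\<^sup>2))"
    using low \<open>0 \<le> K\<close> by (rule mult_left_mono)
  ultimately have "K * (7295 / 10000) \<le> d * (23957 / 10000) / (157 / 50) + d * (63 / 100) * (8657 / 10000)"
    using K by linarith
  also have "\<dots> \<le> (18546 / 10000 * d) * (7295 / 10000)" using d by simp
  finally show ?thesis by simp
qed

section \<open>Normal approximation\<close>

lemma measure_std_normal_le:
  assumes "a \<le> b"
  shows "measure std_normal_distribution {a..<b} \<le> (b - a) / sqrt (2 * pi)"
proof -
  interpret N: real_distribution std_normal_distribution by (rule real_dist_normal_dist)
  have le: "std_normal_density x \<le> 1 / sqrt (2 * pi)" for x
    unfolding std_normal_density_def by (intro mult_left_le) auto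
  have "emeasure std_normal_distribution {a..<b} = (\<integral>\<^sup>+x. ennreal (std_normal_density x) * indicator {a..<b} x \<partial>lborel)"
    by (rule emeasure_density) auto
  also have "\<dots> \<le> (\<integral>\<^sup>+x. ennreal (1 / sqrt (2 * pi)) * indicator {a..<b} x \<partial>lborel)"
    using le by (intro nn_integral_mono mult_right_mono ennreal_leI) auto
  also have "\<dots> = ennreal (1 / sqrt (2 * pi)) * emeasure lborel {a..<b}"
    by (rule nn_integral_cmult_indicator) simp
  also have "\<dots> = ennreal ((b - a) / sqrt (2 * pi))"
    using assms by (simp add: ennreal_mult[symmetric])
  finally show ?thesis
    using assms unfolding N.emeasure_eq_measure by (subst (asm) ennreal_le_iff) auto
qed

text \<open>\<open>std_normal_cdf\<close> integrates over a closed half-line, whereas the smoothing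
  works with open ones. They agree because the Lipschitz bound excludes atoms.\<close>

lemma std_normal_cdf_eq_measure: "std_normal_cdf x = measure std_normal_distribution {..<x}"
proof -
  interpret N: real_distribution std_normal_distribution by (rule real_dist_normal_dist)
  have "measure std_normal_distribution {x} \<le> 0"
  proof (rule field_le_epsilon)
    fix e :: real assume "e > 0"
    have "measure std_normal_distribution {x} \<le> measure std_normal_distribution {x..<x + e * sqrt (2 * pi)}"
      using \<open>e > 0\<close> by (intro N.finite_measure_mono) auto
    also have "\<dots> \<le> (x + e * sqrt (2 * pi) - x) / sqrt (2 * pi)"
      using \<open>e > 0\<close> by (intro measure_std_normal_le) simp
    finally show "measure std_normal_distribution {x} \<le> 0 + e" by simp
  qed
  then have atom: "measure std_normal_distribution {x} = 0"
    using measure_nonneg[of std_normal_distribution "{x}"] by linarith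
  have "measure std_normal_distribution ({..<x} \<union> {x}) = measure std_normal_distribution {..<x}"
    by (subst N.finite_measure_Union) (auto simp: atom)
  moreover have "{..<x} \<union> {x} = {..x}" by auto
  moreover have "measure std_normal_distribution {..x} = std_normal_cdf x"
  proof -
    have "measure std_normal_distribution {..x} = (\<integral>y. indicat_real {..x} y \<partial>std_normal_distribution)"
      by simp
    also have "\<dots> = (\<integral>y. std_normal_density y *\<^sub>R indicat_real {..x} y \<partial>lborel)"
      by (rule integral_density) auto
    finally show ?thesis by (simp add: std_normal_cdf_def set_lebesgue_integral_def mult.commute)
  qed
  ultimately show ?thesis by simp
qed

lemma char_distr_scale:
  assumes [measurable]: "f \<in> borel_measurable M"
  shows "char (distr M borel (\<lambda>\<omega>. c * f \<omega>)) t = char (distr M borel f) (c * t)"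
proof -
  have "char (distr M borel (\<lambda>\<omega>. c * f \<omega>)) t = (\<integral>\<omega>. iexp (t * (c * f \<omega>)) \<partial>M)"
    unfolding char_def by (rule integral_distr) auto
  also have "\<dots> = (\<integral>\<omega>. iexp (c * t * f \<omega>) \<partial>M)"
    by (simp add: mult_ac)
  also have "\<dots> = char (distr M borel f) (c * t)"
    unfolding char_def by (rule integral_distr[symmetric]) auto
  finally show ?thesis .
qed

context poisson_sum
begin

lemma normal_approximation:
  assumes X0: "integrable M (X 0)" "expectation (X 0) = 0" "integrable M (\<lambda>\<omega>. (X 0 \<omega>)\<^sup>2)"
    and B: "B > 0" "B\<^sup>2 = lam * expectation (\<lambda>\<omega>. (X 0 \<omega>)\<^sup>2)"
    and d: "d = lam * expectation (\<lambda>\<omega>. (X 0 \<omega> / B)\<^sup>2 * min 1 \<bar>X 0 \<omega> / B\<bar>)"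
  shows "\<bar>prob {\<omega> \<in> space M. S \<omega> < x * B} - std_normal_cdf x\<bar> \<le> 1.8546 * d"
proof -
  interpret N: real_distribution std_normal_distribution by (rule real_dist_normal_dist)
  define K where "K = \<bar>prob {\<omega> \<in> space M. S \<omega> < x * B} - std_normal_cdf x\<bar>"
  \<comment> \<open>This settles d > 0.5392, because 1.8546 times 0.5392 exceeds 1.\<close>
  have K1: "K \<le> 1"
    using prob_le_1[of "{\<omega> \<in> space M. S \<omega> < x * B}"] N.prob_le_1[of "{..<x}"]
      measure_nonneg[of M "{\<omega> \<in> space M. S \<omega> < x * B}"] measure_nonneg[of std_normal_distribution "{..<x}"]
    unfolding K_def std_normal_cdf_eq_measure abs_le_iff by linarith
  define Y where "Y \<omega> = X 0 \<omega> / B" for \<omega>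
  have Y: "Y \<in> borel_measurable M" "integrable M Y" "integrable M (\<lambda>\<omega>. (Y \<omega>)\<^sup>2)"
    "expectation Y = 0" "lam * expectation (\<lambda>\<omega>. (Y \<omega>)\<^sup>2) = 1"
    using X0 B by (simp_all add: Y_def[abs_def] power_divide flip: B(2))
  have dY: "d = lam * expectation (\<lambda>\<omega>. (Y \<omega>)\<^sup>2 * min 1 \<bar>Y \<omega>\<bar>)"
    by (simp add: d Y_def)
  \<comment> \<open>Required for the cut-off 3/d. If d were 0, then Y would vanish almost surely,
    contrary to lam E Y^2 = 1.\<close>
  have "0 < d"
  proof -
    have im: "integrable M (\<lambda>\<omega>. (Y \<omega>)\<^sup>2 * min 1 \<bar>Y \<omega>\<bar>)"
      by (rule Bochner_Integration.integrable_bound[OF Y(3)])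
         (use Y(1) in \<open>auto simp: abs_mult intro!: AE_I2 mult_left_le\<close>)
    have "0 \<le> expectation (\<lambda>\<omega>. (Y \<omega>)\<^sup>2 * min 1 \<bar>Y \<omega>\<bar>)" by (intro integral_nonneg_AE) auto
    moreover have "expectation (\<lambda>\<omega>. (Y \<omega>)\<^sup>2 * min 1 \<bar>Y \<omega>\<bar>) \<noteq> 0"
    proof
      assume "expectation (\<lambda>\<omega>. (Y \<omega>)\<^sup>2 * min 1 \<bar>Y \<omega>\<bar>) = 0"
      then have "AE \<omega> in M. (Y \<omega>)\<^sup>2 * min 1 \<bar>Y \<omega>\<bar> = 0"
        by (subst (asm) integral_nonneg_eq_0_iff_AE[OF im]) auto
      then have "AE \<omega> in M. (Y \<omega>)\<^sup>2 = 0" by eventually_elim (auto simp: min_def split: if_splits)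
      then have "expectation (\<lambda>\<omega>. (Y \<omega>)\<^sup>2) = 0" by (rule integral_eq_zero_AE)
      with Y(5) show False by simp
    qed
    ultimately have "0 < expectation (\<lambda>\<omega>. (Y \<omega>)\<^sup>2 * min 1 \<bar>Y \<omega>\<bar>)" by linarith
    with lam_pos show ?thesis unfolding dY by (rule mult_pos_pos)
  qed
  have "K \<le> 1.8546 * d"
  proof (cases "d \<le> 5392 / 10000")
    case False
    then show ?thesis using K1 by simp
  next
    case True
    \<comment> \<open>Both laws are scaled by T, so that the cut-off becomes 1, the edge of the
      support of the Fejer transform; the normal distribution function then has Lipschitz constant
      1/(T sqrt(2 pi)). The threshold on d gives T > 5.5, enough for the splitting point
      9/2.\<close>
    define T where "T = 3 / d"
    have T: "T > 0" "T \<ge> 9 / 2" "d * T = 3"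
      using \<open>0 < d\<close> True by (simp_all add: T_def le_divide_eq)
    define P where "P = distr M borel (\<lambda>\<omega>. T / B * S \<omega>)"
    define Q where "Q = distr std_normal_distribution borel (\<lambda>z. T * z)"
    define h where "h t = 3 * (T * t) * (exp (- ((1 - d) / 2) * (T * t)\<^sup>2)
      + indicator {9 / 2..} (T * t) * exp (- 1 / 2 - 23 / 162 * (T * t)\<^sup>2))" for t
    have P: "real_distribution P" unfolding P_def by (rule real_distribution_distr) simp
    have Q: "real_distribution Q" unfolding Q_def by (rule N.real_distribution_distr) simp
    have iP: "integrable P (\<lambda>s. s)"
      unfolding P_def
    proof (subst integrable_distr_eq)
      show "integrable M (\<lambda>\<omega>. T / B * S \<omega>)"
        using integrable_S[OF X0(1)] by (rule integrable_mult_right)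
    qed measurable
    have iQ: "integrable Q (\<lambda>s. s)"
      unfolding Q_def
    proof (subst integrable_distr_eq)
      have "integrable std_normal_distribution (\<lambda>z. z)"
        using integrable_std_normal_distribution_moment[of 1] by simp
      then show "integrable std_normal_distribution (\<lambda>z. T * z)"
        by (rule integrable_mult_right)
    qed simp_all
    have lip: "measure Q {a..<b} \<le> d / (3 * sqrt (2 * pi)) * (b - a)" if "a \<le> b" for a b
    proof -
      have "measure Q {a..<b} = measure std_normal_distribution ((\<lambda>z. T * z) -` {a..<b} \<inter> space std_normal_distribution)"
        unfolding Q_def by (rule measure_distr) auto
      also have "(\<lambda>z. T * z) -` {a..<b} \<inter> space std_normal_distribution = {a / T..<b / T}"
        using T by (auto simp: field_simps)
      also have "measure std_normal_distribution {a / T..<b / T} \<le> (b / T - a / T) / sqrt (2 * pi)"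
        using that T by (intro measure_std_normal_le divide_right_mono) auto
      also have "\<dots> = d / (3 * sqrt (2 * pi)) * (b - a)"
        by (simp add: T_def diff_divide_distrib[symmetric] mult_ac) (simp add: right_diff_distrib mult_ac)
      finally show ?thesis .
    qed
    have bound: "cmod (char P t - char Q t) \<le> t * h t" if t: "0 < t" "t \<le> 1" for t
    proof -
      have "char P t = exp (lam * (char (distr M borel (\<lambda>\<omega>. T / B * X 0 \<omega>)) t - 1))"
        unfolding P_def by (rule char_scaled_S)
      also have "(\<lambda>\<omega>. T / B * X 0 \<omega>) = (\<lambda>\<omega>. T * Y \<omega>)" by (simp add: Y_def)
      also have "char (distr M borel (\<lambda>\<omega>. T * Y \<omega>)) t = char (distr M borel Y) (T * t)"
        by (rule char_distr_scale[OF Y(1)])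
      finally have cP: "char P t = exp (lam * (char (distr M borel Y) (T * t) - 1))" .
      have "char Q t = char (distr std_normal_distribution borel (\<lambda>z. z)) (T * t)"
        unfolding Q_def by (rule char_distr_scale) simp
      also have "distr std_normal_distribution borel (\<lambda>z. z) = std_normal_distribution"
        by (rule distr_id2) simp
      finally have cQ: "char Q t = exp (- (T * t)\<^sup>2 / 2)"
        by (simp add: char_std_normal_distribution)
      have "cmod (char P t - char Q t) \<le> d * (T * t)\<^sup>2 * (exp (- ((1 - d) / 2) * (T * t)\<^sup>2)
          + indicator {9 / 2..} (T * t) * exp (- 1 / 2 - 23 / 162 * (T * t)\<^sup>2))"
        unfolding cP cQ
      proof (rule char_compound_poisson_diff_le[OF Y lam_pos dY])
        have "T * t * d = d * T * t" by (simp only: mult_ac)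
        then have "T * t * d = 3 * t" by (simp only: T(3))
        then show "T * t * d \<le> 3" using t by linarith
      qed (use T t in simp)
      \<comment> \<open>The relation d T = 3 removes \<open>d\<close> from the integrand, and one
        factor \<open>t\<close> is split off to match the form of the smoothing bound.\<close>
      also have "d * (T * t)\<^sup>2 = t * (3 * (T * t))"
        by (subst T(3)[symmetric]) (simp add: power2_eq_square mult_ac)
      finally show ?thesis by (simp add: h_def mult.assoc)
    qed
    note h = gaussian_tail_integrals[OF T(2), of "1 - d", folded h_def]
    have hi: "set_integrable lborel {0..1} h" using h(1) True by simp
    have smooth: "\<bar>measure P {..<T * x} - measure Q {..<T * x}\<bar> * (1 - 8 / (3 * pi\<^sup>2))
        \<le> (LBINT t:{0..1}. h t) / pi + d / (3 * sqrt (2 * pi)) * (3 * pi / 2) * (1 - 4 / (3 * pi\<^sup>2))"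
      by (rule esseen_smoothing[OF P iP Q iQ lip hi bound])
    have "measure P {..<T * x} = measure M ((\<lambda>\<omega>. T / B * S \<omega>) -` {..<T * x} \<inter> space M)"
      unfolding P_def by (rule measure_distr) auto
    also have "(\<lambda>\<omega>. T / B * S \<omega>) -` {..<T * x} \<inter> space M = {\<omega> \<in> space M. S \<omega> < x * B}"
      using T B by (auto simp: field_simps)
    finally have mP: "measure P {..<T * x} = prob {\<omega> \<in> space M. S \<omega> < x * B}" .
    have "measure Q {..<T * x} = measure std_normal_distribution ((\<lambda>z. T * z) -` {..<T * x} \<inter> space std_normal_distribution)"
      unfolding Q_def by (rule measure_distr) auto
    also have "(\<lambda>z. T * z) -` {..<T * x} \<inter> space std_normal_distribution = {..<x}"
      using T by auto
    finally have mQ: "measure Q {..<T * x} = std_normal_cdf x" by (simp add: std_normal_cdf_eq_measure)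
    have "(LBINT t:{0..1}. h t) \<le> 3 / T * (1 / (1 - d) + 81 / 23 * exp (- (27 / 8)))"
      using h(2) True by simp
    also have "3 / T = d" using \<open>0 < d\<close> by (simp add: T_def)
    finally have "(LBINT t:{0..1}. h t) / pi \<le> d * (1 / (1 - d) + 81 / 23 * exp (- (27 / 8))) / pi"
      by (intro divide_right_mono) auto
    with smooth show ?thesis
      unfolding mP mQ K_def[symmetric]
      by (intro numeric_constant_bound[OF _ \<open>0 < d\<close> True]) (auto simp: K_def)
  qed
  then show ?thesis by (simp add: K_def)
qed

end

text \<open>For |x| \<ge> B the monotonicity of g is used, for |x| < B that of x/g(x). The factor
  x^2 settles x = 0, which lies outside the range of both monotonicity conditions.\<close>

lemma class_G_min_le:
  assumes "class_G g" "B > 0"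
  shows "x\<^sup>2 * min 1 \<bar>x / B\<bar> \<le> x\<^sup>2 * g x / g B"
proof (cases "x = 0")
  case False
  have pos: "g y > 0" if "y > 0" for y using assms that by (simp add: class_G_def)
  have gx: "g \<bar>x\<bar> = g x" using assms by (cases "x \<ge> 0") (auto simp: class_G_def)
  have "min 1 \<bar>x / B\<bar> \<le> g \<bar>x\<bar> / g B"
  proof (cases "B \<le> \<bar>x\<bar>")
    case True
    then have "g B \<le> g \<bar>x\<bar>"
      using assms False unfolding class_G_def by (auto elim!: mono_onD)
    then show ?thesis using pos[OF \<open>B > 0\<close>] by (simp add: min.coboundedI1)
  next
    case False': False
    then have "\<bar>x\<bar> / g \<bar>x\<bar> \<le> B / g B"
      using assms False unfolding class_G_def by (auto elim!: mono_onD[where f = "\<lambda>x. x / g x"])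
    then have "\<bar>x\<bar> / B \<le> g \<bar>x\<bar> / g B"
      using pos[OF \<open>B > 0\<close>] pos[of "\<bar>x\<bar>"] \<open>B > 0\<close> False by (simp add: field_simps)
    then show ?thesis using \<open>B > 0\<close> by (simp add: min.coboundedI2)
  qed
  then show ?thesis unfolding gx times_divide_eq_right[symmetric] by (intro mult_left_mono) auto
qed simp

theorem theorem8:
  fixes M :: "'a measure" and X :: "nat \<Rightarrow> 'a \<Rightarrow> real" and N :: "'a \<Rightarrow> nat"
    and lam :: real and g :: "real \<Rightarrow> real"
  assumes "prob_space M"
    and X_rv: "\<And>i. X i \<in> borel_measurable M"
    and N_rv: "N \<in> measurable M (count_space UNIV)"
    and ident: "\<And>i. distr M borel (X i) = distr M borel (X 0)"
    and indep: "prob_space.indep_vars M (\<lambda>_. borel)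
                  (\<lambda>j \<omega>. case j of None \<Rightarrow> real (N \<omega>) | Some i \<Rightarrow> X i \<omega>) UNIV"
    and mean0: "integrable M (X 0)" "prob_space.expectation M (X 0) = 0"
    and var_fin: "integrable M (\<lambda>\<omega>. (X 0 \<omega>)\<^sup>2)"
    and var_pos: "prob_space.expectation M (\<lambda>\<omega>. (X 0 \<omega>)\<^sup>2) > 0"
    and lam_pos: "lam > 0"
    and poisson: "\<And>k. prob_space.prob M {\<omega> \<in> space M. N \<omega> = k} = lam ^ k / fact k * exp (- lam)"
    and gG: "class_G g"
    and g_mom: "integrable M (\<lambda>\<omega>. (X 0 \<omega>)\<^sup>2 * g (X 0 \<omega>))"
  shows "let \<sigma> = sqrt (prob_space.expectation M (\<lambda>\<omega>. (X 0 \<omega>)\<^sup>2)) in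
    \<forall>x::real. \<bar>prob_space.prob M {\<omega> \<in> space M. (\<Sum>i<N \<omega>. X i \<omega>) < x * \<sigma> * sqrt lam}
                 - std_normal_cdf x\<bar>
      \<le> 1.8546 * prob_space.expectation M (\<lambda>\<omega>. (X 0 \<omega>)\<^sup>2 * g (X 0 \<omega>))
               / (\<sigma>\<^sup>2 * g (\<sigma> * sqrt lam))"
proof -
  interpret poisson_sum M X N lam
    by (intro poisson_sum.intro poisson_sum_axioms.intro) fact+
  define v where "v = expectation (\<lambda>\<omega>. (X 0 \<omega>)\<^sup>2)"
  define B where "B = sqrt v * sqrt lam"
  define d where "d = lam * expectation (\<lambda>\<omega>. (X 0 \<omega> / B)\<^sup>2 * min 1 \<bar>X 0 \<omega> / B\<bar>)"
  define E where "E = expectation (\<lambda>\<omega>. (X 0 \<omega>)\<^sup>2 * g (X 0 \<omega>))"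
  have v: "v > 0" using var_pos by (simp add: v_def)
  have B: "B > 0" "B\<^sup>2 = lam * v" using v lam_pos by (simp_all add: B_def power_mult_distrib)
  have gB: "g B > 0" using gG B by (simp add: class_G_def)
  have le: "(X 0 \<omega> / B)\<^sup>2 * min 1 \<bar>X 0 \<omega> / B\<bar> \<le> (X 0 \<omega>)\<^sup>2 * g (X 0 \<omega>) / (B\<^sup>2 * g B)" for \<omega>
    using divide_right_mono[OF class_G_min_le[OF gG B(1), of "X 0 \<omega>"], of "B\<^sup>2"]
    by (simp add: power_divide mult_ac)
  have "expectation (\<lambda>\<omega>. (X 0 \<omega> / B)\<^sup>2 * min 1 \<bar>X 0 \<omega> / B\<bar>)
      \<le> expectation (\<lambda>\<omega>. (X 0 \<omega>)\<^sup>2 * g (X 0 \<omega>) / (B\<^sup>2 * g B))"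
  proof (rule integral_mono_AE')
    show "integrable M (\<lambda>\<omega>. (X 0 \<omega>)\<^sup>2 * g (X 0 \<omega>) / (B\<^sup>2 * g B))" using g_mom by simp
    have "0 \<le> (X 0 \<omega>)\<^sup>2 * g (X 0 \<omega>) / (B\<^sup>2 * g B)" for \<omega>
    proof -
      have "0 \<le> g (X 0 \<omega>)" using gG unfolding class_G_def by blast
      with gB show ?thesis by simp
    qed
    then show "AE \<omega> in M. 0 \<le> (X 0 \<omega>)\<^sup>2 * g (X 0 \<omega>) / (B\<^sup>2 * g B)" by simp
    show "AE \<omega> in M. (X 0 \<omega> / B)\<^sup>2 * min 1 \<bar>X 0 \<omega> / B\<bar> \<le> (X 0 \<omega>)\<^sup>2 * g (X 0 \<omega>) / (B\<^sup>2 * g B)"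
      using le by (rule AE_I2)
  qed
  also have "\<dots> = E / (B\<^sup>2 * g B)" by (simp add: E_def)
  finally have "d \<le> lam * (E / (B\<^sup>2 * g B))"
    unfolding d_def using lam_pos by (intro mult_left_mono) auto
  \<comment> \<open>Since B^2 = lam v, the Poisson parameter survives only in the argument of
    g.\<close>
  also have "\<dots> = E / (v * g B)" unfolding B(2) using lam_pos by simp
  finally have "1.8546 * d \<le> 1.8546 * (E / (v * g B))" by (intro mult_left_mono) auto
  then have dE: "1.8546 * d \<le> 1.8546 * E / (v * g B)" unfolding times_divide_eq_right .
  have "\<bar>prob {\<omega> \<in> space M. S \<omega> < x * B} - std_normal_cdf x\<bar> \<le> 1.8546 * E / (v * g B)" for x
    using normal_approximation[OF mean0 var_fin B[unfolded v_def] d_def, of x] dE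
    by (rule order_trans)
  moreover have "(sqrt v)\<^sup>2 = v" using v by simp
  ultimately show ?thesis
    unfolding Let_def v_def[symmetric] E_def[symmetric] S_def mult.assoc[of _ "sqrt v"] B_def[symmetric]
    by simp
qed

end
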